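(* Let $(P_n)$ be a sequence of entire functions of genus zero, $P_n(z)=a_nz^{\alpha_n}\prod_j(1-z/z_{n,j})$, and let $(k_n)$ be a sequence of positive numbers. Assume that $$C_0^*:=\liminf_{n\to\infty}C(P_n,1)^{1/k_n}>0$$ and that $$\limsup_{n\to\infty}|P_n(z)|^{1/k_n}\le 1\quad\text{for all } z\in\mathbb C .$$ (It is not assumed that $k_n\ge d^*(P_n)$.) Then one of the following two alternatives holds: either 1) for every $m\in\mathbb N$, $$\lim_{R\to\infty}\limsup_{n\to\infty}\frac1{k_n}\sum_{|z_{n,j}|\ge R}\frac1{|z_{n,j}|^m}=\infty;$$ or 2) there exists $m\in\mathbb N$ such that $$\lim_{R\to\infty}\limsup_{n\to\infty}\frac1{k_n}\sum_{|z_{n,j}|\ge R}\frac1{|z_{n,j}|^m}=0 .$$ Moreover, if alternative 2) is the case, then for every $l\in\mathbb N$ $$\lim_{R\to\infty}\limsup_{n\to\infty}\frac1{k_n}\Big|\sum_{|z_{n,j}|\ge R}\frac1{z_{n,j}^l}\Big|=0 .$$ In particular, if $k_n\ge d^*(P_n)$ for all $n\in\mathbb N$, then alternative 2) holds, and hence $$\lim_{R\to\infty}\limsup_{n\to\infty}\frac{\big|\sum_{|z_{n,j}|\ge R}1/z_{n,j}\big|}{k_n}=0$$ and there exists a sequence $(R_n)$ of positive real numbers tending to $\infty$ such that $\limsup_{n\to\infty}\eta(P_n,R_n)/k_n<\infty$.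
   Context: $\mathbb N=\{1,2,\dots\}$. An entire function is called of genus zero if its order is less than $1$. Such a function $P$ (not identically zero) has the form $P(z)=az^{\alpha}\prod_j(1-z/z_j)$, where $a\neq0$, $\alpha\ge0$ is an integer and the $z_j$ are the zeros of $P$ different from $0$, repeated according to multiplicity (finitely or infinitely many). Its degree is $$d^*(P)=\alpha+\#\{j:|z_j|\le1\}+\sum_{|z_j|>1}\frac1{|z_j|}.$$ For an entire function $f$ and $R>0$, $$C(f,R)=\exp\Big\{\frac1{2\pi}\int_0^{2\pi}\log|f(Re^{it})|\,dt\Big\},$$ and $\eta(f,R)$ is the number of zeros of $f$ in $\{0<|z|\le R\}$, counted with multiplicity. *)

theory Defs
  imports "HOL-Complex_Analysis.Complex_Analysis"
begin

text \<open>Order of growth: the infimum of all \<open>\<rho> > 0\<close> such that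
  \<open>\<bar>f z\<bar> \<le> exp (\<bar>z\<bar> powr \<rho>)\<close> for all sufficiently large \<open>\<bar>z\<bar>\<close>
  (\<open>\<infinity>\<close> if there is no such \<open>\<rho>\<close>).\<close>

definition growth_order :: "(complex \<Rightarrow> complex) \<Rightarrow> ereal" where
  "growth_order f =
     Inf {ereal \<rho> |\<rho>::real. \<rho> > 0 \<and>
            (\<forall>\<^sub>F z in at_infinity. cmod (f z) \<le> exp (cmod z powr \<rho>))}"

definition genus_zero :: "(complex \<Rightarrow> complex) \<Rightarrow> bool" where
  "genus_zero f \<longleftrightarrow> f holomorphic_on UNIV \<and> growth_order f < 1"

text \<open>The zeros \<open>z\<^sub>j\<close>, repeated according to multiplicity, are encoded as the set
  of zeros different from \<open>0\<close> weighted by \<open>zero_mult\<close>; everything below is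
  meant for entire \<open>f\<close> that are not identically zero. For such \<open>f\<close>,
  \<open>zorder f z\<close> is a nonnegative integer, and it is \<open>0\<close> where \<open>f z \<noteq> 0\<close>.\<close>

definition zero_mult :: "(complex \<Rightarrow> complex) \<Rightarrow> complex \<Rightarrow> nat" where
  "zero_mult f z = nat (zorder f z)"

definition nonzero_zeros :: "(complex \<Rightarrow> complex) \<Rightarrow> complex set" where
  "nonzero_zeros f = {z. f z = 0 \<and> z \<noteq> 0}"

definition zero_count :: "(complex \<Rightarrow> complex) \<Rightarrow> real \<Rightarrow> nat" where
  "zero_count f R = (\<Sum>z \<in> {z \<in> nonzero_zeros f. cmod z \<le> R}. zero_mult f z)"

definition degree_star :: "(complex \<Rightarrow> complex) \<Rightarrow> ennreal" where
  "degree_star f =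
     of_nat (zero_mult f 0) + of_nat (zero_count f 1) +
     (\<Sum>\<^sub>\<infinity>z \<in> {z \<in> nonzero_zeros f. cmod z > 1}.
        of_nat (zero_mult f z) * ennreal (1 / cmod z))"

text \<open>For \<open>f\<close> not identically zero, the convention \<open>ln 0 = 0\<close> only affects the
  integrand at finitely many points.\<close>

definition circle_geom_mean :: "(complex \<Rightarrow> complex) \<Rightarrow> real \<Rightarrow> real" where
  "circle_geom_mean f R =
     exp (1 / (2 * pi) * integral {0..2 * pi} (\<lambda>t. ln (cmod (f (of_real R * cis t)))))"

definition abs_tail_sum :: "(complex \<Rightarrow> complex) \<Rightarrow> nat \<Rightarrow> real \<Rightarrow> ennreal" where
  "abs_tail_sum f m R =
     (\<Sum>\<^sub>\<infinity>z \<in> {z \<in> nonzero_zeros f. cmod z \<ge> R}.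
        of_nat (zero_mult f z) * ennreal (1 / cmod z ^ m))"

text \<open>For an entire function of order less than \<open>1\<close> that is not identically zero
  and \<open>l \<ge> 1\<close>, this sum converges absolutely.\<close>

definition tail_sum :: "(complex \<Rightarrow> complex) \<Rightarrow> nat \<Rightarrow> real \<Rightarrow> complex" where
  "tail_sum f l R =
     (\<Sum>\<^sub>\<infinity>z \<in> {z \<in> nonzero_zeros f. cmod z \<ge> R}. of_nat (zero_mult f z) * (1 / z ^ l))"

end

(*
  Divide out of P n its zeros in a disc of radius R and write the rest as exp h. Since P n has order
  less than 1, the l-th Taylor coefficient of h is - (1/l) times the sum of the z_j^(-l) over the
  zeros of modulus > R; so the power sums are Fourier coefficients of ln |P n| on a circle, up to the
  contribution of the inner zeros.

  Since S_(m+1)(R) <= S_m(R) / R for the tail sums S_m of |z_j|^(-m), one finite limit forces the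
  next one to vanish, which is the dichotomy; k n >= degree gives S_1 <= k n. For the remaining claims
  one needs that (1/k n) ln |P n| is locally bounded above, although it is only bounded pointwise. The
  Baire theorem gives a small disc with a uniform bound on the disc and its rotations by roots of
  unity. Averaging over these rotations removes the uncontrolled Taylor polynomial of h of degree
  < m, and with the lower bound on the unit circle this controls the number of zeros, and then the
  polynomial itself. Dominated convergence now makes the mean of the positive part of ln |P n| on
  every circle o(k n), so by Jensen's formula the number of zeros in a disc is at most const * k n and
  the l-th power sum is at most const * k n / R^l, with constants independent of R.
*)
theory Submission
  imports Defs "HOL-Real_Asymp.Real_Asymp"
begin

section \<open>Mean values of logarithms on circles\<close>

text \<open>Two quantities escape a bound on the m-th tail sum: the number N of zeros of modulus
  below R0, and the Taylor coefficients of h of degree below m. For N, two estimates of Re (h 0) are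
  compared. The mean over the unit circle bounds it from below and loses at most ln (1 + R0) per
  inner zero. The small disc bounds it from above and, with its rotations at distance at least e (1
  + R0) from those zeros, gains at least 1 + ln (1 + R0) per zero. Together they leave N itself. The
  rotations are 2m in number so that no sum or nonzero difference of two frequencies between 1 and m
  - 1 is a multiple of 2m; a one-sided bound at the rotated points then bounds the coefficients.

  The local bound so obtained has constants depending on the radius. It serves only as a dominating
  function; uniformity in R comes back because the positive parts have limit 0. Order below 1 enters
  through the cofactor coefficients, which are O(R^(rho - l)) with rho < 1 <= l: they vanish as R
  grows, and comparing the cofactors of two radii turns them into power sums.\<close>

lemma has_integral_cis_mean_value:
  assumes "h holomorphic_on ball 0 R'" "0 < r" "r < R'"
  shows "((\<lambda>t. h (of_real r * cis t)) has_integral (2 * of_real pi * h 0)) {0..2*pi}"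
proof -
  have "((\<lambda>u. h u / (u - 0)) has_contour_integral 2 * of_real pi * \<i> * h 0) (circlepath 0 r)"
    by (rule Cauchy_integral_circlepath_simple)
       (use assms in \<open>auto intro: holomorphic_on_subset[OF assms(1)]\<close>)
  then have "((\<lambda>t. h (0 + of_real r * cis t) / (0 + of_real r * cis t - 0) * r * \<i> * cis t)
      has_integral (2 * of_real pi * \<i> * h 0)) {0..2*pi}"
    unfolding circlepath_def by (subst (asm) has_contour_integral_part_circlepath_iff) auto
  then have "((\<lambda>t. \<i> * h (of_real r * cis t)) has_integral \<i> * (2 * of_real pi * h 0)) {0..2*pi}"
    using assms by (simp add: mult_ac)
  from has_integral_mult_right[OF this, of "-\<i>"]
  have "((\<lambda>t. - (\<i> * \<i>) * h (of_real r * cis t)) has_integral - (\<i> * \<i>) * (2 * of_real pi * h 0)) {0..2*pi}"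
    by (simp only: mult.assoc mult_minus_left)
  then show ?thesis
    by simp
qed

text \<open>The integrand is the real part of \<open>Ln (1 - w * z)\<close>, holomorphic on a disc
  of radius \<open>1 / cmod w > 1\<close>, so the mean is the value 0 at the centre.\<close>

lemma ln_cmod_one_minus_mean:
  fixes w :: complex
  assumes "cmod w < 1"
  shows "((\<lambda>t. ln (cmod (1 - w * cis t))) has_integral 0) {0..2*pi}"
proof (cases "w = 0")
  case False
  have *: "1 - w * z \<notin> \<real>\<^sub>\<le>\<^sub>0" if "z \<in> ball 0 (1 / cmod w)" for z
  proof -
    have "cmod (w * z) < 1"
      using that False by (simp add: norm_mult field_simps)
    then have "Re (1 - w * z) > 0"
      using complex_Re_le_cmod[of "w * z"] by simp
    then show ?thesis
      by (metis complex_nonpos_Reals_iff not_less)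
  qed
  have "((\<lambda>t. Ln (1 - w * (of_real 1 * cis t))) has_integral (2 * of_real pi * Ln (1 - w * 0))) {0..2*pi}"
  proof (rule has_integral_cis_mean_value)
    show "(\<lambda>z. Ln (1 - w * z)) holomorphic_on ball 0 (1 / cmod w)"
      by (intro holomorphic_intros *)
  qed (use assms False in auto)
  from has_integral_Re[OF this] have "((\<lambda>t. Re (Ln (1 - w * cis t))) has_integral 0) {0..2*pi}"
    by simp
  moreover have "Re (Ln (1 - w * cis t)) = ln (cmod (1 - w * cis t))" for t
    using *[of "cis t"] assms False by (subst Re_Ln) auto
  ultimately show ?thesis
    by simp
qed auto

text \<open>Serves to discard the finitely many parameters at which the convention
  \<open>ln 0 = 0\<close> distorts an integrand. The two endpoints of the interval give the same
  point, hence possibly more than one parameter.\<close>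

lemma finite_circle_fibre: "finite {t \<in> {0..2*pi}. r * cis t = (a::complex)}" if "r \<noteq> 0"
proof -
  have *: "t = s \<or> \<bar>t - s\<bar> = 2 * pi"
    if "cis t = cis s" "t \<in> {0..2*pi}" "s \<in> {0..2*pi}" for t s
  proof -
    have "cis (t - s) = 1"
      using that by (simp flip: cis_divide)
    then have "cos (t - s) = 1"
      by (metis cis.sel(1) one_complex.sel(1))
    then obtain x::int where "t - s = of_int x * (2 * pi)"
      using cos_one_2pi_int by auto
    moreover have "\<bar>t - s\<bar> \<le> 2 * pi"
      using that by auto
    ultimately have "\<bar>of_int x\<bar> * (2 * pi) \<le> 1 * (2 * pi)"
      by (simp add: abs_mult)
    then have "\<bar>of_int x :: real\<bar> \<le> 1"
      by (simp add: mult_le_cancel_right)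
    then have "\<bar>x\<bar> \<le> 1"
      by linarith
    then have "x = 0 \<or> x = 1 \<or> x = -1"
      by linarith
    with \<open>t - s = _\<close> show ?thesis
      by auto
  qed
  show ?thesis
  proof (cases "\<exists>s \<in> {0..2*pi}. r * cis s = a")
    case True
    then obtain s where s: "s \<in> {0..2*pi}" "r * cis s = a"
      by auto
    have "{t \<in> {0..2*pi}. r * cis t = a} \<subseteq> {s, s - 2*pi, s + 2*pi}"
      using *[OF _ _ s(1)] s \<open>r \<noteq> 0\<close> by fastforce
    then show ?thesis
      by (rule finite_subset) auto
  next
    case False
    then have "{t \<in> {0..2*pi}. r * cis t = a} = {}"
      by auto
    then show ?thesis
      by (simp only: finite.emptyI)
  qed
qed

text \<open>On the unit circle itself the integrand is unbounded. The functions
  \<open>ln \<bar>1 - s w cis t\<bar> - ln s / 2\<close> decrease to it as \<open>s\<close> increases to \<open>1\<close>, because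
  \<open>\<bar>1 - s w cis t\<bar>\<^sup>2 / s = s + 1 / s - 2 Re (w cis t)\<close>.\<close>

lemma ln_cmod_one_minus_mean_unit:
  fixes w :: complex
  assumes w: "cmod w = 1"
  shows "((\<lambda>t. ln (cmod (1 - w * cis t))) has_integral 0) {0..2*pi}"
proof -
  define T where "T = {t \<in> {0..2*pi}. w * cis t = 1}"
  define S where "S = {0..2*pi} - T"
  \<comment> \<open>The shift by 2 keeps \<open>s k\<close> strictly between 0 and 1 already at
    \<open>k = 0\<close>.\<close>
  define s :: "nat \<Rightarrow> real" where "s k = 1 - 1 / real (k + 2)" for k
  define \<phi> where "\<phi> k t = ln (cmod (1 - of_real (s k) * w * cis t)) - ln (s k) / 2" for k t
  have "finite T"
    unfolding T_def using w by (intro finite_circle_fibre) auto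
  have S_iff: "(f has_integral y) S \<longleftrightarrow> (f has_integral y) {0..2*pi}" for f :: "real \<Rightarrow> real" and y
    by (rule has_integral_spike_set_eq)
       (auto simp: S_def intro!: negligible_finite finite_subset[OF _ \<open>finite T\<close>])
  have s: "0 < s k" "s k < 1" "s k \<le> s (Suc k)" for k
    by (auto simp: s_def field_simps)
  have ne: "1 - of_real (s k) * w * cis t \<noteq> 0" for k t
  proof
    assume "1 - of_real (s k) * w * cis t = 0"
    then have "cmod (of_real (s k) * w * cis t) = 1"
      by (metis eq_iff_diff_eq_0 norm_one)
    then show False
      using s[of k] w by (simp add: norm_mult)
  qed
  have cm: "(cmod (1 - of_real x * w * cis t))\<^sup>2 = 1 - 2 * x * Re (w * cis t) + x\<^sup>2" for x t
  proof -
    have "(Re (w * cis t))\<^sup>2 + (Im (w * cis t))\<^sup>2 = 1"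
      using w unfolding cmod_power2[symmetric] by (simp add: norm_mult)
    moreover have "(cmod (1 - of_real x * (w * cis t)))\<^sup>2
        = (1 - x * Re (w * cis t))\<^sup>2 + (x * Im (w * cis t))\<^sup>2"
      unfolding cmod_power2 by simp
    ultimately have "(cmod (1 - of_real x * (w * cis t)))\<^sup>2
        = 1 - 2 * x * Re (w * cis t) + x\<^sup>2"
      by algebra
    then show ?thesis
      by (simp add: mult.assoc)
  qed
  have ph: "\<phi> k t = ln (s k + 1 / s k - 2 * Re (w * cis t)) / 2" for k t
  proof -
    have "ln (s k + 1 / s k - 2 * Re (w * cis t)) = ln ((cmod (1 - of_real (s k) * w * cis t))\<^sup>2 / s k)"
      unfolding cm using s[of k] by (simp add: field_simps power2_eq_square)
    also have "\<dots> = 2 * ln (cmod (1 - of_real (s k) * w * cis t)) - ln (s k)"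
      using s[of k] ne by (subst ln_div) (auto simp: ln_realpow)
    finally show ?thesis
      by (simp add: \<phi>_def field_simps)
  qed
  have pos: "s k + 1 / s k - 2 * Re (w * cis t) > 0" for k t
  proof -
    have "s k + 1 / s k - 2 * Re (w * cis t) = (cmod (1 - of_real (s k) * w * cis t))\<^sup>2 / s k"
      unfolding cm using s[of k] by (simp add: field_simps power2_eq_square)
    then show ?thesis
      using s[of k] ne by simp
  qed
  have int: "(\<phi> k has_integral - pi * ln (s k)) S" for k
  proof -
    have "((\<lambda>t. ln (cmod (1 - (of_real (s k) * w) * cis t))) has_integral 0) {0..2*pi}"
      by (rule ln_cmod_one_minus_mean) (use w s[of k] in \<open>simp add: norm_mult\<close>)
    from has_integral_diff[OF this has_integral_const_real[of "ln (s k) / 2"]]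
    have "(\<phi> k has_integral - pi * ln (s k)) {0..2*pi}"
      by (simp add: \<phi>_def[abs_def])
    then show ?thesis
      by (simp only: S_iff)
  qed
  have slim: "s \<longlonglongrightarrow> 1"
    unfolding s_def by real_asymp
  have lim: "(\<lambda>k. - pi * ln (s k)) \<longlonglongrightarrow> 0"
    using tendsto_mult[OF tendsto_const tendsto_ln[OF slim], of "-pi"] by simp
  have mono: "\<phi> (Suc k) t \<le> \<phi> k t" for k t
  proof -
    have "s k * s (Suc k) \<le> 1"
      using s[of k] s[of "Suc k"] by (simp add: mult_le_one)
    \<comment> \<open>The factored form of the decrease of x + 1/x on (0, 1).\<close>
    then have "0 \<le> (s (Suc k) - s k) * (1 - s k * s (Suc k)) / (s k * s (Suc k))"
      using s[of k] s[of "Suc k"] by (intro divide_nonneg_pos mult_nonneg_nonneg) auto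
    also have "\<dots> = (s k + 1 / s k) - (s (Suc k) + 1 / s (Suc k))"
      using s[of k] s[of "Suc k"] by (simp add: field_simps)
    finally show ?thesis
      unfolding ph using pos[of k t] pos[of "Suc k" t] by (simp add: ln_mono)
  qed
  have "(\<lambda>t. ln (cmod (1 - w * cis t))) integrable_on S \<and>
     (\<lambda>k. integral S (\<phi> k)) \<longlonglongrightarrow> integral S (\<lambda>t. ln (cmod (1 - w * cis t)))"
  proof (rule monotone_convergence_decreasing)
    show "\<phi> k integrable_on S" for k
      using int by blast
    show "(\<lambda>k. \<phi> k t) \<longlonglongrightarrow> ln (cmod (1 - w * cis t))" if "t \<in> S" for t
    proof -
      have "1 - 1 * w * cis t \<noteq> 0"
        using that by (auto simp: S_def T_def)
      then have "(\<lambda>k. \<phi> k t) \<longlonglongrightarrow> ln (cmod (1 - of_real 1 * w * cis t)) - ln 1 / 2"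
        unfolding \<phi>_def by (intro tendsto_intros slim) auto
      then show ?thesis
        by simp
    qed
    show "bounded (range (\<lambda>k. integral S (\<phi> k)))"
      using convergent_imp_bounded[OF lim] by (simp only: integral_unique[OF int])
  qed (rule mono)
  moreover from this have "integral S (\<lambda>t. ln (cmod (1 - w * cis t))) = 0"
    using lim integral_unique[OF int] LIMSEQ_unique by auto
  ultimately have "((\<lambda>t. ln (cmod (1 - w * cis t))) has_integral 0) S"
    by (simp add: has_integral_iff)
  then show ?thesis
    by (simp only: S_iff)
qed

text \<open>Jensen's formula for one linear factor: once the larger of \<open>r\<close> and
  \<open>cmod a\<close> is pulled out, what remains is \<open>cmod (1 - w * cis t)\<close> with
  \<open>cmod w \<le> 1\<close>, whose logarithm has mean 0.\<close>

lemma has_integral_ln_cmod_diff: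
  fixes a :: complex
  assumes "r > 0"
  shows "((\<lambda>t. ln (cmod (of_real r * cis t - a))) has_integral 2 * pi * ln (max r (cmod a))) {0..2*pi}"
proof -
  have one: "((\<lambda>t. ln (cmod (1 - w * cis t))) has_integral 0) {0..2*pi}" if "cmod w \<le> 1" for w
    using that ln_cmod_one_minus_mean[of w] ln_cmod_one_minus_mean_unit[of w] by linarith
  define T where "T = {t \<in> {0..2*pi}. of_real r * cis t = a}"
  have "finite T"
    unfolding T_def using assms by (intro finite_circle_fibre) auto
  \<comment> \<open>For \<open>cmod a \<le> r\<close>, conjugating and multiplying by
    \<open>cis t\<close> turns the factor into \<open>r - cnj a * cis t\<close> without changing its
    modulus.\<close>
  define w where "w = (if cmod a \<le> r then cnj a / r else r / a)"
  have w: "cmod w \<le> 1"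
    using assms by (auto simp: w_def norm_divide divide_le_eq)
  have eq: "cmod (of_real r * cis t - a) = max r (cmod a) * cmod (1 - w * cis t)" for t
  proof (cases "cmod a \<le> r")
    case True
    have "cmod (of_real r * cis t - a) = cmod (cnj (of_real r * cis t - a) * cis t)"
      by (simp only: norm_mult complex_mod_cnj norm_cis mult_1_right)
    also have "cnj (of_real r * cis t - a) * cis t = of_real r * (1 - w * cis t)"
      using True assms by (simp add: w_def field_simps cis_cnj cis_mult)
    finally show ?thesis
      using True assms by (simp add: norm_mult)
  next
    case False
    then have "a \<noteq> 0"
      using assms by auto
    with False have "of_real r * cis t - a = - a * (1 - w * cis t)"
      by (simp add: w_def field_simps)
    then show ?thesis
      using False by (simp add: norm_mult)
  qed
  have "((\<lambda>t. ln (max r (cmod a)) + ln (cmod (1 - w * cis t))) has_integral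
      2 * pi * ln (max r (cmod a))) {0..2*pi}"
    using has_integral_add[OF has_integral_const_real[of "ln (max r (cmod a))" 0 "2*pi"] one[OF w]]
    by (simp add: mult.commute)
  then show ?thesis
  proof (rule has_integral_spike_finite[OF \<open>finite T\<close>, rotated])
    fix t assume "t \<in> {0..2*pi} - T"
    then have "cmod (of_real r * cis t - a) \<noteq> 0"
      by (auto simp: T_def)
    then show "ln (cmod (of_real r * cis t - a)) = ln (max r (cmod a)) + ln (cmod (1 - w * cis t))"
      using assms unfolding eq by (subst ln_mult) auto
  qed
qed

section \<open>Entire functions with their zeros divided out\<close>

text \<open>In Re h = (h + cnj h) / 2 the conjugate has no positive frequencies, so half of the l-th
  coefficient of h survives; hence pi and not 2 pi. The constant \<open>b\<close> is invisible at
  frequency \<open>l \<ge> 1\<close> and will absorb a normalisation.\<close>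

lemma has_integral_Re_Fourier:
  fixes b :: real
  assumes h: "h holomorphic_on ball 0 R'" and r: "0 < r" "r < R'" and "l \<ge> 1"
  shows "((\<lambda>t. of_real (Re (h (of_real r * cis t)) + b) * cis (- (real l * t))) has_integral
    of_real pi * of_real r ^ l * ((deriv ^^ l) h 0 / fact l)) {0..2*pi}"
proof -
  have hol': "h holomorphic_on ball 0 r" "continuous_on (cball 0 r) h"
    using r by (auto intro: holomorphic_on_subset[OF h] continuous_on_subset[OF holomorphic_on_imp_continuous_on[OF h]])
  have "((\<lambda>u. h u / (u - 0) ^ Suc l) has_contour_integral
      2 * of_real pi * \<i> / fact l * (deriv ^^ l) h 0) (circlepath 0 r)"
    using Cauchy_has_contour_integral_higher_derivative_circlepath[OF hol'(2,1), of 0 l] r by simp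
  then have "((\<lambda>t. h (0 + of_real r * cis t) / (0 + of_real r * cis t - 0) ^ Suc l * r * \<i> * cis t)
      has_integral (2 * of_real pi * \<i> / fact l * (deriv ^^ l) h 0)) {0..2*pi}"
    unfolding circlepath_def by (subst (asm) has_contour_integral_part_circlepath_iff) auto
  moreover have "h (0 + of_real r * cis t) / (0 + of_real r * cis t - 0) ^ Suc l * r * \<i> * cis t
      = \<i> * inverse (of_real r ^ l) * (h (of_real r * cis t) * cis (- (real l * t)))" for t
  proof -
    have "cis (- (real l * t)) = inverse (cis t ^ l)"
      by (simp add: Complex.DeMoivre flip: cis_inverse)
    then show ?thesis
      using r by (simp add: power_mult_distrib field_simps)
  qed
  ultimately have "((\<lambda>t. \<i> * inverse (of_real r ^ l) * (h (of_real r * cis t) * cis (- (real l * t))))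
      has_integral (2 * of_real pi * \<i> / fact l * (deriv ^^ l) h 0)) {0..2*pi}"
    by (simp only:)
  from has_integral_mult_right[OF this, of "- \<i> * of_real r ^ l"]
  have 1: "((\<lambda>t. h (of_real r * cis t) * cis (- (real l * t))) has_integral
      2 * of_real pi * of_real r ^ l * ((deriv ^^ l) h 0 / fact l)) {0..2*pi}"
    using r by (simp add: field_simps)
  \<comment> \<open>This function vanishes at 0 because \<open>l \<ge> 1\<close>, so its mean is 0;
    its conjugate supplies the antiholomorphic half. The final halving explains
    \<open>2 * b\<close>.\<close>
  have "((\<lambda>t. (of_real r * cis t) ^ l * (h (of_real r * cis t) + 2 * b)) has_integral
      2 * of_real pi * (0 ^ l * (h 0 + 2 * b))) {0..2*pi}"
    by (rule has_integral_cis_mean_value[OF _ r]) (auto intro!: holomorphic_intros h)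
  from has_integral_mult_right[OF this, of "inverse (of_real r ^ l)"]
  have "((\<lambda>t. cis (real l * t) * (h (of_real r * cis t) + 2 * b)) has_integral 0) {0..2*pi}"
    using r \<open>l \<ge> 1\<close> by (simp add: power_mult_distrib Complex.DeMoivre mult.assoc[symmetric] power_0_left)
  then have "(cnj \<circ> (\<lambda>t. cis (real l * t) * (h (of_real r * cis t) + 2 * b)) has_integral cnj 0) {0..2*pi}"
    by (subst has_integral_cnj)
  from has_integral_add[OF 1 this]
  have "((\<lambda>t. h (of_real r * cis t) * cis (- (real l * t))
        + cis (- (real l * t)) * (cnj (h (of_real r * cis t)) + 2 * b)) has_integral
      2 * of_real pi * of_real r ^ l * ((deriv ^^ l) h 0 / fact l)) {0..2*pi}"
    by (simp add: o_def cis_cnj)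
  from has_integral_mult_right[OF this, of "1/2"]
  have 2: "((\<lambda>t. 1/2 * (h (of_real r * cis t) * cis (- (real l * t))
        + cis (- (real l * t)) * (cnj (h (of_real r * cis t)) + 2 * b))) has_integral
      of_real pi * of_real r ^ l * ((deriv ^^ l) h 0 / fact l)) {0..2*pi}"
    by (simp add: mult.assoc)
  have 3: "1/2 * (h (of_real r * cis t) * cis (- (real l * t))
        + cis (- (real l * t)) * (cnj (h (of_real r * cis t)) + 2 * b)) =
      of_real (Re (h (of_real r * cis t)) + b) * cis (- (real l * t))" for t
  proof -
    have Re_eq: "complex_of_real (Re z) = (z + cnj z) / 2" for z
      by (simp add: complex_add_cnj)
    show ?thesis
      unfolding of_real_add Re_eq by (simp add: field_simps)
  qed
  show ?thesis
    using 2 unfolding 3 .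
qed

text \<open>An upper bound and the integral already control the L1 norm, because
  \<open>\<bar>x\<bar> \<le> 2 * b - x\<close> for \<open>x \<le> b\<close> and
  \<open>b \<ge> 0\<close>.\<close>

lemma integral_abs_le_upper:
  fixes f :: "real \<Rightarrow> real"
  assumes f: "(f has_integral I) {0..2*pi}" and le: "\<And>t. f t \<le> b" and "b \<ge> 0"
  shows "(\<lambda>t. \<bar>f t\<bar>) integrable_on {0..2*pi}" "integral {0..2*pi} (\<lambda>t. \<bar>f t\<bar>) \<le> 4 * pi * b - I"
proof -
  have "f absolutely_integrable_on {0..2*pi}"
    by (rule absolutely_integrable_component_ubound[where g = "\<lambda>_. b"]) (use assms in auto)
  then show 1: "(\<lambda>t. \<bar>f t\<bar>) integrable_on {0..2*pi}"
    by (auto simp: absolutely_integrable_on_def)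
  have 2: "((\<lambda>t. 2 * b - f t) has_integral (4 * pi * b - I)) {0..2*pi}"
    using has_integral_diff[OF has_integral_const_real[of "2*b" 0 "2*pi"] f] by (simp add: mult_ac)
  show "integral {0..2*pi} (\<lambda>t. \<bar>f t\<bar>) \<le> 4 * pi * b - I"
  proof (rule has_integral_le[OF integrable_integral[OF 1] 2])
    fix t show "\<bar>f t\<bar> \<le> 2 * b - f t"
      using le[of t] \<open>b \<ge> 0\<close> by linarith
  qed
qed

section \<open>Jensen's formula, zero counts and Taylor coefficients of the cofactor\<close>

definition zeros_upto :: "(complex \<Rightarrow> complex) \<Rightarrow> real \<Rightarrow> complex set" where
  "zeros_upto f R = {z. f z = 0 \<and> cmod z \<le> R}"

text \<open>Unlike \<open>zero_count\<close>, this includes the zero at the origin.\<close>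

definition full_count :: "(complex \<Rightarrow> complex) \<Rightarrow> real \<Rightarrow> real" where
  "full_count f R = (\<Sum>\<zeta>\<in>zeros_upto f R. real (zero_mult f \<zeta>))"

text \<open>\<open>exp h\<close> is what remains of \<open>f\<close> near \<open>cball 0 R\<close> after its zeros there have been divided out.\<close>

definition log_cofactor :: "(complex \<Rightarrow> complex) \<Rightarrow> real \<Rightarrow> real \<Rightarrow> (complex \<Rightarrow> complex) \<Rightarrow> bool" where
  "log_cofactor f R R' h \<longleftrightarrow> R < R' \<and> h holomorphic_on ball 0 R' \<and>
    (\<forall>z\<in>ball 0 R'. f z = (\<Prod>\<zeta>\<in>zeros_upto f R. (z - \<zeta>) ^ zero_mult f \<zeta>) * exp (h z))"

text \<open>The geometric mean \<open>circle_geom_mean f R\<close> is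
  \<open>exp (circle_log f R / (2 * pi))\<close>.\<close>

definition circle_log :: "(complex \<Rightarrow> complex) \<Rightarrow> real \<Rightarrow> real" where
  "circle_log f R = integral {0..2*pi} (\<lambda>t. ln (cmod (f (of_real R * cis t))))"

text \<open>Up to the factor 2 pi this is Nevanlinna's proximity function, with
  \<open>ln (max 1 x)\<close> for the positive part of the logarithm.\<close>

definition circle_log_plus :: "(complex \<Rightarrow> complex) \<Rightarrow> real \<Rightarrow> real" where
  "circle_log_plus f R = integral {0..2*pi} (\<lambda>t. ln (max 1 (cmod (f (of_real R * cis t)))))"

locale nonzero_entire =
  fixes f :: "complex \<Rightarrow> complex"
  assumes hol: "f holomorphic_on UNIV" and nonzero: "\<exists>z. f z \<noteq> 0"
begin

lemma finite_zeros_upto: "finite (zeros_upto f R)"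
proof (cases "f constant_on UNIV")
  case True
  then have "zeros_upto f R = {}"
    using nonzero by (auto simp: constant_on_def zeros_upto_def)
  then show ?thesis
    by simp
next
  case False
  have "finite {z \<in> cball 0 R. f z = 0}"
    by (rule holomorphic_compact_finite_zeros[OF hol]) (use False in auto)
  also have "{z \<in> cball 0 R. f z = 0} = zeros_upto f R"
    by (auto simp: zeros_upto_def)
  finally show ?thesis .
qed

lemma frequently_nonzero: "\<exists>\<^sub>F w in at z. f w \<noteq> 0"
proof -
  obtain b where "f b \<noteq> 0"
    using nonzero by auto
  then have "\<forall>\<^sub>F w in at z. f w \<noteq> 0 \<and> w \<in> UNIV"
    using non_zero_neighbour_alt[OF hol, of z b] by auto
  then show ?thesis
    by (intro eventually_frequently) (auto elim: eventually_mono)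
qed

lemma analytic_at_point: "f analytic_on {z}"
  using hol analytic_at by blast

lemma zorder_nonneg: "zorder f z \<ge> 0"
  by (intro zorder_ge_0 analytic_at_point frequently_nonzero)

lemma zero_mult_pos: "f z = 0 \<Longrightarrow> zero_mult f z > 0"
  using zorder_pos_iff'[OF analytic_at_point frequently_nonzero, of z] by (simp add: zero_mult_def)

text \<open>On a slightly larger disc without further zeros, f and the polynomial \<open>q\<close>
  have the same zeros with the same orders. The quotient is then zero-free on a disc and has a
  holomorphic logarithm.\<close>

lemma exists_log_cofactor:
  obtains R' h where "log_cofactor f R R' h"
proof (cases "R < 0")
  case True
  then have "log_cofactor f R 0 (\<lambda>_. 0)"
    by (simp add: log_cofactor_def)
  then show ?thesis
    by (rule that)
next
  case False
  define A where "A = zeros_upto f (R + 1) - zeros_upto f R"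
  have "finite A"
    by (simp add: A_def finite_zeros_upto)
  have gt: "cmod z > R" if "z \<in> A" for z
    using that by (auto simp: A_def zeros_upto_def)
  \<comment> \<open>No zero of modulus between \<open>R\<close> and \<open>R'\<close> remains;
    \<open>R + 1\<close> also covers the case of empty \<open>A\<close>.\<close>
  define R' where "R' = Min (insert (R + 1) (cmod ` A))"
  have "R' > R"
    using \<open>finite A\<close> gt by (simp add: R'_def)
  have in_R: "\<zeta> \<in> zeros_upto f R" if "f \<zeta> = 0" "cmod \<zeta> < R'" for \<zeta>
  proof (rule ccontr)
    assume "\<zeta> \<notin> zeros_upto f R"
    moreover have "R' \<le> R + 1"
      using \<open>finite A\<close> by (auto simp: R'_def)
    ultimately have "\<zeta> \<in> A"
      using that by (auto simp: A_def zeros_upto_def)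
    then have "R' \<le> cmod \<zeta>"
      using \<open>finite A\<close> by (auto simp: R'_def)
    with that show False
      by simp
  qed
  define q where "q z = (\<Prod>\<zeta>\<in>zeros_upto f R. (z - \<zeta>) ^ zero_mult f \<zeta>)" for z
  have q_hol: "q holomorphic_on S" for S
    unfolding q_def by (intro holomorphic_intros)
  have q0: "q z = 0 \<longleftrightarrow> z \<in> zeros_upto f R" for z
    using finite_zeros_upto zero_mult_pos by (auto simp: q_def zeros_upto_def)
  have zo: "zorder q z = zorder f z" if "z \<in> ball 0 R'" for z
  proof (cases "f z = 0")
    case False
    then have "zorder f z = 0"
      by (intro zorder_eq_0I analytic_at_point)
    moreover have "zorder q z = 0"
      using False q0[of z] q_hol[of UNIV]
      by (intro zorder_eq_0I) (auto simp: zeros_upto_def analytic_at)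
    ultimately show ?thesis
      by simp
  next
    case True
    then have z: "z \<in> zeros_upto f R"
      using that in_R by auto
    define q' where "q' w = (\<Prod>\<zeta>\<in>zeros_upto f R - {z}. (w - \<zeta>) ^ zero_mult f \<zeta>)" for w
    show ?thesis
    proof (rule zorder_eqI)
      show "q' holomorphic_on UNIV"
        unfolding q'_def by (intro holomorphic_intros)
      show "q' z \<noteq> 0"
        unfolding q'_def using finite_zeros_upto by auto
      fix w assume "w \<noteq> z"
      have "q w = (w - z) ^ zero_mult f z * q' w"
        unfolding q_def q'_def by (rule prod.remove[OF finite_zeros_upto z])
      also have "(w - z) ^ zero_mult f z = (w - z) powi zorder f z"
        using zorder_nonneg[of z] by (simp add: zero_mult_def power_int_def)
      finally show "q w = q' w * (w - z) powi zorder f z"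
        by simp
    qed auto
  qed
  obtain g where g: "g holomorphic_on ball 0 R'" "\<And>z. z \<in> ball 0 R' \<Longrightarrow> g z \<noteq> 0"
      "\<And>z. z \<in> ball 0 R' \<Longrightarrow> f z = g z * q z"
  proof (rule holomorphic_zorder_factorization)
    show "f holomorphic_on ball 0 R'"
      using hol by (rule holomorphic_on_subset) auto
    show "(q z = 0) = (f z = 0)" if "z \<in> ball 0 R'" for z
      using in_R[of z] that by (auto simp: q0 zeros_upto_def)
    show "zorder q z = zorder f z" if "z \<in> ball 0 R'" for z
      by (rule zo[OF that])
  qed (auto intro: q_hol that)
  have "0 \<in> ball 0 R'"
    using False \<open>R' > R\<close> by simp
  then obtain h where "h holomorphic_on ball 0 R'" "\<And>z. z \<in> ball 0 R' \<Longrightarrow> exp (h z) = g z"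
    using holomorphic_logarithm_exists[OF convex_ball open_ball g(1,2)] by metis
  then have "log_cofactor f R R' h"
    using g(3) \<open>R' > R\<close> by (auto simp: log_cofactor_def q_def)
  then show ?thesis
    by (rule that)
qed

lemma finite_circle_zeros:
  assumes "r > 0"
  shows "finite {t \<in> {0..2*pi}. f (of_real r * cis t) = 0}"
proof -
  have "finite (\<Union>\<zeta>\<in>zeros_upto f r. {t \<in> {0..2*pi}. of_real r * cis t = \<zeta>})"
    using assms by (intro finite_UN_I finite_zeros_upto finite_circle_fibre) auto
  then show ?thesis
    by (rule rev_finite_subset) (use assms in \<open>auto simp: zeros_upto_def norm_mult\<close>)
qed

lemma ln_cmod_log_cofactor:
  assumes "log_cofactor f R R' h" "cmod z < R'" "f z \<noteq> 0"
  shows "ln (cmod (f z)) = (\<Sum>\<zeta>\<in>zeros_upto f R. real (zero_mult f \<zeta>) * ln (cmod (z - \<zeta>))) + Re (h z)"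
proof -
  have eq: "f z = (\<Prod>\<zeta>\<in>zeros_upto f R. (z - \<zeta>) ^ zero_mult f \<zeta>) * exp (h z)"
    using assms by (auto simp: log_cofactor_def)
  then have nz: "(\<Prod>\<zeta>\<in>zeros_upto f R. (z - \<zeta>) ^ zero_mult f \<zeta>) \<noteq> 0"
    using assms(3) by auto
  have nz': "z - \<zeta> \<noteq> 0" if "\<zeta> \<in> zeros_upto f R" for \<zeta>
    using assms(3) that by (auto simp: zeros_upto_def)
  have "ln (cmod (f z)) = ln (\<Prod>\<zeta>\<in>zeros_upto f R. cmod (z - \<zeta>) ^ zero_mult f \<zeta>) + Re (h z)"
    using nz unfolding eq norm_mult
    by (subst ln_mult) (simp_all add: prod_norm norm_power[symmetric] del: prod_zero_iff)
  also have "ln (\<Prod>\<zeta>\<in>zeros_upto f R. cmod (z - \<zeta>) ^ zero_mult f \<zeta>)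
      = (\<Sum>\<zeta>\<in>zeros_upto f R. ln (cmod (z - \<zeta>) ^ zero_mult f \<zeta>))"
    using nz' by (intro ln_prod finite_zeros_upto) auto
  also have "\<dots> = (\<Sum>\<zeta>\<in>zeros_upto f R. real (zero_mult f \<zeta>) * ln (cmod (z - \<zeta>)))"
    using nz' by (intro sum.cong) (auto simp: ln_realpow)
  finally show ?thesis .
qed

text \<open>Jensen's formula: \<open>Re h\<close> contributes its value at 0 and each linear factor
  its own mean. Zeros are divided out up to \<open>R\<close> while the circle has radius
  \<open>r \<le> R\<close>, so that one \<open>h\<close> can serve two radii.\<close>

lemma has_integral_ln_cmod_circle:
  assumes h: "log_cofactor f R R' h" and r: "0 < r" "r \<le> R"
  shows "((\<lambda>t. ln (cmod (f (of_real r * cis t)))) has_integral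
    2 * pi * (Re (h 0) + (\<Sum>\<zeta>\<in>zeros_upto f R. real (zero_mult f \<zeta>) * ln (max r (cmod \<zeta>))))) {0..2*pi}"
proof (rule has_integral_spike_finite[OF finite_circle_zeros[OF r(1)]])
  have h': "h holomorphic_on ball 0 R'" "r < R'"
    using h r by (auto simp: log_cofactor_def)
  have "((\<lambda>t. Re (h (of_real r * cis t))) has_integral Re (2 * of_real pi * h 0)) {0..2*pi}"
    by (intro has_integral_Re has_integral_cis_mean_value[OF h'(1) r(1) h'(2)])
  moreover have "((\<lambda>t. \<Sum>\<zeta>\<in>zeros_upto f R. real (zero_mult f \<zeta>) * ln (cmod (of_real r * cis t - \<zeta>))) has_integral
      (\<Sum>\<zeta>\<in>zeros_upto f R. real (zero_mult f \<zeta>) * (2 * pi * ln (max r (cmod \<zeta>))))) {0..2*pi}"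
    by (intro has_integral_sum finite_zeros_upto has_integral_mult_right has_integral_ln_cmod_diff r)
  ultimately have "((\<lambda>t. (\<Sum>\<zeta>\<in>zeros_upto f R. real (zero_mult f \<zeta>) * ln (cmod (of_real r * cis t - \<zeta>)))
        + Re (h (of_real r * cis t))) has_integral
      (\<Sum>\<zeta>\<in>zeros_upto f R. real (zero_mult f \<zeta>) * (2 * pi * ln (max r (cmod \<zeta>)))) + Re (2 * of_real pi * h 0)) {0..2*pi}"
    by (intro has_integral_add)
  also have "(\<Sum>\<zeta>\<in>zeros_upto f R. real (zero_mult f \<zeta>) * (2 * pi * ln (max r (cmod \<zeta>)))) + Re (2 * of_real pi * h 0)
      = 2 * pi * (Re (h 0) + (\<Sum>\<zeta>\<in>zeros_upto f R. real (zero_mult f \<zeta>) * ln (max r (cmod \<zeta>))))"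
    by (simp add: algebra_simps sum_distrib_left)
  finally show "((\<lambda>t. (\<Sum>\<zeta>\<in>zeros_upto f R. real (zero_mult f \<zeta>) * ln (cmod (of_real r * cis t - \<zeta>)))
        + Re (h (of_real r * cis t))) has_integral
      2 * pi * (Re (h 0) + (\<Sum>\<zeta>\<in>zeros_upto f R. real (zero_mult f \<zeta>) * ln (max r (cmod \<zeta>))))) {0..2*pi}" .
  fix t assume "t \<in> {0..2*pi} - {t \<in> {0..2*pi}. f (of_real r * cis t) = 0}"
  then show "ln (cmod (f (of_real r * cis t))) =
      (\<Sum>\<zeta>\<in>zeros_upto f R. real (zero_mult f \<zeta>) * ln (cmod (of_real r * cis t - \<zeta>))) + Re (h (of_real r * cis t))"
    using r h'(2) by (intro ln_cmod_log_cofactor[OF h]) (auto simp: norm_mult)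
qed

lemma circle_log_eq:
  assumes "log_cofactor f R R' h" "0 < r" "r \<le> R"
  shows "circle_log f r =
    2 * pi * (Re (h 0) + (\<Sum>\<zeta>\<in>zeros_upto f R. real (zero_mult f \<zeta>) * ln (max r (cmod \<zeta>))))"
  unfolding circle_log_def by (rule integral_unique[OF has_integral_ln_cmod_circle[OF assms]])

lemma integrable_circle_log:
  assumes "0 < r"
  shows "(\<lambda>t. ln (cmod (f (of_real r * cis t)))) integrable_on {0..2*pi}"
proof -
  obtain R' h where "log_cofactor f r R' h"
    by (rule exists_log_cofactor)
  from has_integral_ln_cmod_circle[OF this assms order_refl] show ?thesis
    by blast
qed

lemma continuous_on_circle: "continuous_on S (\<lambda>t. f (of_real r * cis t))"
  by (rule continuous_on_compose2[OF holomorphic_on_imp_continuous_on[OF hol]])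
     (auto intro!: continuous_intros)

lemma integrable_circle_log_plus:
  "(\<lambda>t. ln (max 1 (cmod (f (of_real r * cis t))))) integrable_on {0..2*pi}"
  by (intro integrable_continuous_real continuous_intros continuous_on_circle) auto

lemma circle_log_le_plus:
  assumes "0 < r"
  shows "circle_log f r \<le> circle_log_plus f r"
  unfolding circle_log_def circle_log_plus_def
proof (rule integral_le[OF integrable_circle_log[OF assms] integrable_circle_log_plus])
  fix t :: real
  show "ln (cmod (f (of_real r * cis t))) \<le> ln (max 1 (cmod (f (of_real r * cis t))))"
    by (cases "f (of_real r * cis t) = 0") auto
qed

lemma full_count_nonneg: "full_count f R \<ge> 0"
  by (simp add: full_count_def sum_nonneg)

text \<open>With a common cofactor, the radius enters Jensen's formula only through
  \<open>ln (max r (cmod \<zeta>))\<close>.\<close>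

lemma circle_log_mono:
  assumes "0 < r" "r \<le> R"
  shows "circle_log f r \<le> circle_log f R"
proof -
  obtain R' h where h: "log_cofactor f R R' h"
    by (rule exists_log_cofactor)
  have "ln (max r (cmod \<zeta>)) \<le> ln (max R (cmod \<zeta>))" for \<zeta>
    using assms by (intro ln_mono) auto
  then show ?thesis
    using assms unfolding circle_log_eq[OF h assms] circle_log_eq[OF h order.strict_trans2[OF assms] order_refl]
    by (intro mult_left_mono add_left_mono sum_mono) auto
qed

text \<open>From the unit circle to radius \<open>2 * R\<close> every zero raises the logarithmic
  mean, and a zero of modulus at most \<open>R\<close> raises it by at least ln (2R) - ln R = ln
  2.\<close>

lemma full_count_le:
  assumes "1 \<le> R"
  shows "2 * pi * ln 2 * full_count f R \<le> circle_log_plus f (2 * R) - circle_log f 1"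
proof -
  obtain R' h where h: "log_cofactor f (2 * R) R' h"
    by (rule exists_log_cofactor)
  define d where "d \<zeta> = ln (max (2 * R) (cmod \<zeta>)) - ln (max 1 (cmod \<zeta>))" for \<zeta> :: complex
  have d0: "d \<zeta> \<ge> 0" for \<zeta>
    unfolding d_def using assms by (simp add: ln_mono)
  have d2: "d \<zeta> \<ge> ln 2" if "cmod \<zeta> \<le> R" for \<zeta>
  proof -
    have "ln (max 1 (cmod \<zeta>)) \<le> ln R"
      using that assms by (intro ln_mono) auto
    moreover have "ln (2 * R) \<le> ln (max (2 * R) (cmod \<zeta>))"
      using assms by (intro ln_mono) auto
    ultimately show ?thesis
      using assms by (simp add: d_def ln_mult)
  qed
  have "ln 2 * full_count f R = (\<Sum>\<zeta>\<in>zeros_upto f R. real (zero_mult f \<zeta>) * ln 2)"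
    by (simp add: full_count_def sum_distrib_left mult.commute)
  also have "\<dots> \<le> (\<Sum>\<zeta>\<in>zeros_upto f R. real (zero_mult f \<zeta>) * d \<zeta>)"
    by (intro sum_mono mult_left_mono d2) (auto simp: zeros_upto_def)
  also have "\<dots> \<le> (\<Sum>\<zeta>\<in>zeros_upto f (2 * R). real (zero_mult f \<zeta>) * d \<zeta>)"
    using assms by (intro sum_mono2 finite_zeros_upto) (auto simp: zeros_upto_def d0)
  finally have "2 * pi * (ln 2 * full_count f R) \<le>
      2 * pi * (\<Sum>\<zeta>\<in>zeros_upto f (2 * R). real (zero_mult f \<zeta>) * d \<zeta>)"
    by (intro mult_left_mono) auto
  also have "\<dots> = circle_log f (2 * R) - circle_log f 1"
    using assms by (subst (1 2) circle_log_eq[OF h]) (auto simp: d_def algebra_simps sum_subtractf)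
  also have "circle_log f (2 * R) \<le> circle_log_plus f (2 * R)"
    using assms by (intro circle_log_le_plus) auto
  finally show ?thesis
    by simp
qed

text \<open>On the circle \<open>Re h\<close> is ln |f| minus the logarithms of the inner factors.
  The first has L1 norm 2 log-plus minus log. Each of the others, normalised by ln R, has mean 0 and
  upper bound ln 2, hence L1 norm at most 4 pi ln 2. Together these bound every Fourier
  coefficient.\<close>

lemma log_cofactor_coeff_le:
  assumes h: "log_cofactor f R R' h" and R: "R \<ge> 1" and l: "l \<ge> 1"
  shows "pi * R ^ l * cmod ((deriv ^^ l) h 0 / fact l)
    \<le> 2 * circle_log_plus f R - circle_log f R + 4 * pi * ln 2 * full_count f R"
proof -
  have R0: "R > 0"
    using R by simp
  have h': "h holomorphic_on ball 0 R'" "R < R'"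
    using h by (auto simp: log_cofactor_def)
  \<comment> \<open>The total of the normalisations by ln R, one for each inner zero; as a constant
    it leaves frequency \<open>l\<close> unchanged.\<close>
  define b where "b = full_count f R * ln R"
  define \<phi> where "\<phi> t = Re (h (of_real R * cis t)) + b" for t
  define u where "u t = ln (cmod (f (of_real R * cis t)))" for t
  define v where "v \<zeta> t = ln (cmod (of_real R * cis t - \<zeta>)) - ln R" for \<zeta> t
  define G where "G t = 2 * ln (max 1 (cmod (f (of_real R * cis t)))) - u t
    + (\<Sum>\<zeta>\<in>zeros_upto f R. real (zero_mult f \<zeta>) * \<bar>v \<zeta> t\<bar>)" for t
  define T where "T = {t \<in> {0..2*pi}. f (of_real R * cis t) = 0}"
  have "finite T"
    unfolding T_def by (rule finite_circle_zeros[OF R0])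
  have up: "((\<lambda>t. 2 * ln (max 1 (cmod (f (of_real R * cis t)))) - u t) has_integral
      2 * circle_log_plus f R - circle_log f R) {0..2*pi}"
    unfolding circle_log_plus_def circle_log_def u_def
    by (intro has_integral_diff has_integral_mult_right integrable_integral
          integrable_circle_log integrable_circle_log_plus R0)
  have v_int: "(\<lambda>t. \<bar>v \<zeta> t\<bar>) integrable_on {0..2*pi}"
       "integral {0..2*pi} (\<lambda>t. \<bar>v \<zeta> t\<bar>) \<le> 4 * pi * ln 2 - 0" if "\<zeta> \<in> zeros_upto f R" for \<zeta>
  proof -
    have \<zeta>: "cmod \<zeta> \<le> R"
      using that by (simp add: zeros_upto_def)
    have 1: "(v \<zeta> has_integral 0) {0..2*pi}"
      using has_integral_diff[OF has_integral_ln_cmod_diff[OF R0, of \<zeta>] has_integral_const_real[of "ln R" 0 "2*pi"]] \<zeta>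
      by (simp add: v_def[abs_def] max_absorb1)
    have 2: "v \<zeta> t \<le> ln 2" for t
    proof (cases "of_real R * cis t = \<zeta>")
      case True
      \<comment> \<open>At the zero itself \<open>ln 0 = 0\<close> makes \<open>v \<zeta> t\<close>
        equal to \<open>- ln R\<close>, which is bounded by means of
        \<open>R \<ge> 1\<close>.\<close>
      have "ln R \<ge> 0" "ln (2::real) \<ge> 0"
        using R by auto
      then have "- ln R \<le> ln 2"
        by linarith
      with True show ?thesis
        by (simp add: v_def)
    next
      case False
      have "cmod (of_real R * cis t - \<zeta>) \<le> R + R"
        using norm_triangle_ineq4[of "of_real R * cis t" \<zeta>] \<zeta> R0 by (simp add: norm_mult)
      then have "ln (cmod (of_real R * cis t - \<zeta>)) \<le> ln (2 * R)"
        using False by (intro ln_mono) auto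
      then show ?thesis
        using R0 by (simp add: v_def ln_mult)
    qed
    show "(\<lambda>t. \<bar>v \<zeta> t\<bar>) integrable_on {0..2*pi}"
      "integral {0..2*pi} (\<lambda>t. \<bar>v \<zeta> t\<bar>) \<le> 4 * pi * ln 2 - 0"
      by (rule integral_abs_le_upper[OF 1 2]; simp)+
  qed
  define I where "I = 2 * circle_log_plus f R - circle_log f R
    + (\<Sum>\<zeta>\<in>zeros_upto f R. real (zero_mult f \<zeta>) * integral {0..2*pi} (\<lambda>t. \<bar>v \<zeta> t\<bar>))"
  have G: "(G has_integral I) {0..2*pi}"
    unfolding G_def[abs_def] I_def
    by (intro has_integral_add up has_integral_sum finite_zeros_upto has_integral_mult_right
          integrable_integral v_int(1))
  have "((\<lambda>t. of_real (\<phi> t) * cis (- (real l * t))) has_integral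
    of_real pi * of_real R ^ l * ((deriv ^^ l) h 0 / fact l)) {0..2*pi}"
    unfolding \<phi>_def by (rule has_integral_Re_Fourier[OF h'(1) R0 h'(2) l])
  \<comment> \<open>On the zero set the formula expressing \<open>\<phi>\<close> through
    \<open>u\<close> and \<open>v\<close> fails, so the integrand is set to 0 on this finite
    set.\<close>
  then have F: "((\<lambda>t. if t \<in> T then 0 else of_real (\<phi> t) * cis (- (real l * t))) has_integral
    of_real pi * of_real R ^ l * ((deriv ^^ l) h 0 / fact l)) {0..2*pi}"
    by (rule has_integral_spike_finite[OF \<open>finite T\<close>, rotated]) auto
  have le: "cmod (if t \<in> T then 0 else of_real (\<phi> t) * cis (- (real l * t))) \<le> G t" if "t \<in> {0..2*pi}" for t
  proof (cases "f (of_real R * cis t) = 0")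
    case True
    then show ?thesis
      using that by (auto simp: T_def G_def u_def intro!: sum_nonneg)
  next
    case False
    have "u t = (\<Sum>\<zeta>\<in>zeros_upto f R. real (zero_mult f \<zeta>) * ln (cmod (of_real R * cis t - \<zeta>)))
        + Re (h (of_real R * cis t))"
      unfolding u_def using h'(2) R0 False by (intro ln_cmod_log_cofactor[OF h]) (auto simp: norm_mult)
    then have "\<phi> t = u t - (\<Sum>\<zeta>\<in>zeros_upto f R. real (zero_mult f \<zeta>) * v \<zeta> t)"
      by (simp add: \<phi>_def v_def b_def full_count_def sum_subtractf right_diff_distrib sum_distrib_right)
    then have "\<bar>\<phi> t\<bar> \<le> \<bar>u t\<bar> + \<bar>\<Sum>\<zeta>\<in>zeros_upto f R. real (zero_mult f \<zeta>) * v \<zeta> t\<bar>"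
      by linarith
    also have "\<bar>\<Sum>\<zeta>\<in>zeros_upto f R. real (zero_mult f \<zeta>) * v \<zeta> t\<bar>
        \<le> (\<Sum>\<zeta>\<in>zeros_upto f R. real (zero_mult f \<zeta>) * \<bar>v \<zeta> t\<bar>)"
      by (rule order_trans[OF sum_abs]) (simp add: abs_mult)
    also have "\<bar>u t\<bar> = 2 * ln (max 1 (cmod (f (of_real R * cis t)))) - u t"
      using False by (auto simp: u_def max_def)
    finally have "\<bar>\<phi> t\<bar> \<le> G t"
      by (simp add: G_def)
    moreover have "t \<notin> T"
      using False by (simp add: T_def)
    ultimately show ?thesis
      by (simp add: norm_mult)
  qed
  have "cmod (of_real pi * of_real R ^ l * ((deriv ^^ l) h 0 / fact l)) \<le> I"
    using integral_norm_bound_integral[OF has_integral_integrable[OF F] has_integral_integrable[OF G] le]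
    unfolding integral_unique[OF F] integral_unique[OF G] .
  also have "I \<le> 2 * circle_log_plus f R - circle_log f R
      + (\<Sum>\<zeta>\<in>zeros_upto f R. real (zero_mult f \<zeta>) * (4 * pi * ln 2))"
    unfolding I_def using v_int(2) by (intro add_left_mono sum_mono mult_left_mono) auto
  also have "(\<Sum>\<zeta>\<in>zeros_upto f R. real (zero_mult f \<zeta>) * (4 * pi * ln 2)) = 4 * pi * ln 2 * full_count f R"
    by (simp add: full_count_def sum_distrib_left mult_ac)
  finally show ?thesis
    using R0 by (simp add: norm_mult norm_power norm_divide)
qed

end

section \<open>Taylor coefficients as power sums of zeros\<close>

text \<open>At \<open>n = 0\<close> division by zero gives coefficient 0, which is the correct
  constant term.\<close>

lemma Ln_one_minus_has_fps_expansion: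
  fixes \<zeta> :: complex
  assumes "\<zeta> \<noteq> 0"
  shows "(\<lambda>z. Ln (1 - z / \<zeta>)) has_fps_expansion Abs_fps (\<lambda>n. - (1 / (of_nat n * \<zeta> ^ n)))"
proof (rule has_fps_expansionI)
  have "eventually (\<lambda>z. z \<in> ball 0 (cmod \<zeta>)) (nhds 0)"
    using assms by (intro eventually_nhds_in_open) auto
  then show "\<forall>\<^sub>F z in nhds 0. (\<lambda>n. fps_nth (Abs_fps (\<lambda>n. - (1 / (of_nat n * \<zeta> ^ n)))) n * z ^ n) sums Ln (1 - z / \<zeta>)"
  proof eventually_elim
    case (elim z)
    then have "cmod (- z / \<zeta>) < 1"
      using assms by (simp add: norm_divide)
    from Ln_series'[OF this] show ?case
      by (simp add: power_divide mult.commute)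
  qed
qed

text \<open>The two cofactors differ near \<open>0\<close> by the logarithms \<open>Ln (1 - z / \<zeta>)\<close> of the factors in
  between, up to a constant.\<close>

lemma (in nonzero_entire) log_cofactor_coeff_diff:
  assumes h: "log_cofactor f R R' h" and g: "log_cofactor f S S' g" and RS: "0 < R" "R \<le> S" and l: "l \<ge> 1"
  shows "(deriv ^^ l) h 0 / fact l = (deriv ^^ l) g 0 / fact l
    - (\<Sum>\<zeta>\<in>zeros_upto f S - zeros_upto f R. of_nat (zero_mult f \<zeta>) * (1 / \<zeta> ^ l)) / of_nat l"
proof -
  define B where "B = zeros_upto f S - zeros_upto f R"
  define D where "D z = h z - g z - (\<Sum>\<zeta>\<in>B. of_nat (zero_mult f \<zeta>) * Ln (1 - z / \<zeta>))" for z
  \<comment> \<open>The constant value of \<open>exp (D z)\<close>, left over when each factor is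
    written as \<open>z - \<zeta> = - \<zeta> * (1 - z / \<zeta>)\<close>.\<close>
  define K where "K = (\<Prod>\<zeta>\<in>B. (- \<zeta>) ^ zero_mult f \<zeta>)"
  have "finite B"
    by (simp add: B_def finite_zeros_upto)
  have h': "h holomorphic_on ball 0 R'" "R < R'" and g': "g holomorphic_on ball 0 S'" "S < S'"
    using h g by (auto simp: log_cofactor_def)
  have gt: "cmod \<zeta> > R" if "\<zeta> \<in> B" for \<zeta>
    using that by (auto simp: B_def zeros_upto_def)
  have nonpos: "1 - z / \<zeta> \<notin> \<real>\<^sub>\<le>\<^sub>0" if "z \<in> ball 0 R" "\<zeta> \<in> B" for z \<zeta>
  proof -
    have "cmod (z / \<zeta>) < 1"
      using that gt[OF that(2)] RS by (simp add: norm_divide divide_less_eq)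
    then have "Re (1 - z / \<zeta>) > 0"
      using complex_Re_le_cmod[of "z / \<zeta>"] by simp
    then show ?thesis
      by (metis complex_nonpos_Reals_iff not_less)
  qed
  have D_hol: "D holomorphic_on ball 0 R"
    unfolding D_def using RS h'(2) g'(2) nonpos gt
    by (intro holomorphic_intros holomorphic_on_subset[OF h'(1)] holomorphic_on_subset[OF g'(1)]) fastforce+
  have expD: "exp (D z) = K" if z: "z \<in> ball 0 R" "f z \<noteq> 0" for z
  proof -
    have "f z = (\<Prod>\<zeta>\<in>zeros_upto f R. (z - \<zeta>) ^ zero_mult f \<zeta>) * exp (h z)"
      using h z RS by (auto simp: log_cofactor_def)
    moreover have "f z = (\<Prod>\<zeta>\<in>zeros_upto f S. (z - \<zeta>) ^ zero_mult f \<zeta>) * exp (g z)"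
      using g z RS by (auto simp: log_cofactor_def)
    moreover have "(\<Prod>\<zeta>\<in>zeros_upto f S. (z - \<zeta>) ^ zero_mult f \<zeta>) =
        (\<Prod>\<zeta>\<in>B. (z - \<zeta>) ^ zero_mult f \<zeta>) * (\<Prod>\<zeta>\<in>zeros_upto f R. (z - \<zeta>) ^ zero_mult f \<zeta>)"
      unfolding B_def using RS by (intro prod.subset_diff finite_zeros_upto) (auto simp: zeros_upto_def)
    ultimately have "exp (h z) = (\<Prod>\<zeta>\<in>B. (z - \<zeta>) ^ zero_mult f \<zeta>) * exp (g z)"
      using z(2) by auto
    also have "(\<Prod>\<zeta>\<in>B. (z - \<zeta>) ^ zero_mult f \<zeta>) =
        (\<Prod>\<zeta>\<in>B. (- \<zeta>) ^ zero_mult f \<zeta> * exp (of_nat (zero_mult f \<zeta>) * Ln (1 - z / \<zeta>)))"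
    proof (intro prod.cong refl)
      fix \<zeta> assume \<zeta>: "\<zeta> \<in> B"
      then have "\<zeta> \<noteq> 0"
        using gt RS by fastforce
      have "1 - z / \<zeta> \<noteq> 0"
        using nonpos[OF z(1) \<zeta>] by auto
      then have "exp (of_nat (zero_mult f \<zeta>) * Ln (1 - z / \<zeta>)) = (1 - z / \<zeta>) ^ zero_mult f \<zeta>"
        by (simp add: exp_of_nat_mult)
      then have "(- \<zeta>) ^ zero_mult f \<zeta> * exp (of_nat (zero_mult f \<zeta>) * Ln (1 - z / \<zeta>)) = (- \<zeta> * (1 - z / \<zeta>)) ^ zero_mult f \<zeta>"
        by (simp only: power_mult_distrib)
      also have "- \<zeta> * (1 - z / \<zeta>) = z - \<zeta>"
        using \<open>\<zeta> \<noteq> 0\<close> by (simp add: field_simps)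
      finally show "(z - \<zeta>) ^ zero_mult f \<zeta> = (- \<zeta>) ^ zero_mult f \<zeta> * exp (of_nat (zero_mult f \<zeta>) * Ln (1 - z / \<zeta>))"
        by simp
    qed
    also have "\<dots> = K * exp (\<Sum>\<zeta>\<in>B. of_nat (zero_mult f \<zeta>) * Ln (1 - z / \<zeta>))"
      using \<open>finite B\<close> by (simp add: K_def prod.distrib exp_sum)
    finally have "exp (h z) = K * exp (\<Sum>\<zeta>\<in>B. of_nat (zero_mult f \<zeta>) * Ln (1 - z / \<zeta>)) * exp (g z)" .
    then show ?thesis
      by (simp add: D_def exp_diff)
  qed
  obtain b where "f b \<noteq> 0"
    using nonzero by auto
  then have "\<forall>\<^sub>F w in at 0. f w \<noteq> 0 \<and> w \<in> UNIV"
    using non_zero_neighbour_alt[OF hol, of 0 b] by auto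
  moreover have inball: "\<forall>\<^sub>F w in nhds 0. w \<in> ball 0 R"
    using RS by (intro eventually_nhds_in_open) auto
  then have "\<forall>\<^sub>F w in at 0. w \<in> ball 0 R"
    by (auto simp: eventually_at_filter elim: eventually_mono)
  ultimately have ev: "\<forall>\<^sub>F w in at 0. exp (D w) = K"
    by eventually_elim (auto intro: expD)
  \<comment> \<open>Since f may vanish at 0, \<open>exp (D z) = K\<close> is so far known only on a
    punctured neighbourhood; continuity supplies the centre.\<close>
  have D_cont: "isCont D 0"
    using RS holomorphic_on_imp_continuous_on[OF D_hol] continuous_on_interior[of "ball 0 R" D 0]
    by (auto simp: interior_open)
  then have "((\<lambda>w. exp (D w)) \<longlongrightarrow> exp (D 0)) (at 0)"
    by (intro tendsto_intros) (simp add: isCont_def)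
  moreover have "((\<lambda>w. exp (D w)) \<longlongrightarrow> K) (at 0)"
    using ev by (rule tendsto_eventually)
  ultimately have D0: "exp (D 0) = K"
    using tendsto_unique[OF trivial_limit_at] by blast
  have "\<forall>\<^sub>F w in at 0. dist (D w) (D 0) < 2 * pi"
    using D_cont by (intro tendstoD) (auto simp: isCont_def)
  with ev have "\<forall>\<^sub>F w in at 0. D w = D 0"
  proof eventually_elim
    case (elim w)
    \<comment> \<open>Values of a logarithm of \<open>K\<close> differ by multiples of 2 pi i; by
      continuity only the multiple 0 is possible near 0.\<close>
    have "\<bar>Im (D w) - Im (D 0)\<bar> < 2 * pi"
      using abs_Im_le_cmod[of "D w - D 0"] elim by (simp add: dist_norm)
    then show ?case
      by (rule exp_complex_eqI) (use elim D0 in simp)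
  qed
  then have "\<forall>\<^sub>F w in nhds 0. D w = D 0"
    by (simp add: eventually_nhds_conv_at)
  then have ev_h: "\<forall>\<^sub>F w in nhds 0. h w = D 0 + g w + (\<Sum>\<zeta>\<in>B. of_nat (zero_mult f \<zeta>) * Ln (1 - w / \<zeta>))"
    by eventually_elim (simp add: D_def algebra_simps)
  have h_an: "h has_fps_expansion fps_expansion h 0" and g_an: "g has_fps_expansion fps_expansion g 0"
    by (rule has_fps_expansion_fps_expansion[OF _ _ h'(1)] has_fps_expansion_fps_expansion[OF _ _ g'(1)];
        use RS h'(2) g'(2) in simp)+
  define G where "G = fps_const (D 0) + fps_expansion g 0
    + (\<Sum>\<zeta>\<in>B. fps_const (of_nat (zero_mult f \<zeta>)) * Abs_fps (\<lambda>n. - (1 / (of_nat n * \<zeta> ^ n))))"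
  have "(\<lambda>w. D 0 + g w + (\<Sum>\<zeta>\<in>B. of_nat (zero_mult f \<zeta>) * Ln (1 - w / \<zeta>))) has_fps_expansion G"
    unfolding G_def using gt RS
    by (intro fps_expansion_intros g_an Ln_one_minus_has_fps_expansion) fastforce
  then have "h has_fps_expansion G"
    using has_fps_expansion_cong[OF ev_h refl, of G] by simp
  then have "(deriv ^^ l) h 0 / fact l = fps_nth G l"
    by (simp add: fps_nth_fps_expansion)
  also have "\<dots> = fps_nth (fps_expansion g 0) l
      - (\<Sum>\<zeta>\<in>B. of_nat (zero_mult f \<zeta>) * (1 / \<zeta> ^ l)) / of_nat l"
    using l by (simp add: G_def fps_sum_nth sum_negf sum_divide_distrib mult.commute)
  also have "fps_nth (fps_expansion g 0) l = (deriv ^^ l) g 0 / fact l"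
    using g_an by (simp add: fps_nth_fps_expansion)
  finally show ?thesis
    by (simp add: B_def)
qed

section \<open>Growth of order below one and power sums over all outer zeros\<close>

locale genus_zero_entire = nonzero_entire +
  assumes order: "growth_order f < 1"
begin

lemma circle_log_plus_growth:
  obtains \<rho> R0 where "0 < \<rho>" "\<rho> < 1" "R0 \<ge> 1" "\<And>R. R \<ge> R0 \<Longrightarrow> circle_log_plus f R \<le> 2 * pi * R powr \<rho>"
proof -
  obtain \<rho> where \<rho>: "ereal \<rho> < 1" "\<rho> > 0" "\<forall>\<^sub>F z in at_infinity. cmod (f z) \<le> exp (cmod z powr \<rho>)"
    using order unfolding growth_order_def Inf_less_iff by auto
  then obtain b where b: "\<And>z. cmod z \<ge> b \<Longrightarrow> cmod (f z) \<le> exp (cmod z powr \<rho>)"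
    unfolding eventually_at_infinity by auto
  show ?thesis
  proof (rule that)
    show "max 1 b \<ge> 1" by simp
    fix R assume R: "max 1 b \<le> R"
    have c: "((\<lambda>_. R powr \<rho>) has_integral 2 * pi * R powr \<rho>) {0..2*pi}"
      using has_integral_const_real[of "R powr \<rho>" 0 "2*pi"] by simp
    show "circle_log_plus f R \<le> 2 * pi * R powr \<rho>"
      unfolding circle_log_plus_def
    proof (rule has_integral_le[OF integrable_integral[OF integrable_circle_log_plus] c])
      fix t
      have "cmod (f (of_real R * cis t)) \<le> exp (R powr \<rho>)"
        using b[of "of_real R * cis t"] R by (simp add: norm_mult)
      then have "max 1 (cmod (f (of_real R * cis t))) \<le> exp (R powr \<rho>)"
        by simp
      then have "ln (max 1 (cmod (f (of_real R * cis t)))) \<le> ln (exp (R powr \<rho>))"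
        by (intro ln_mono) auto
      then show "ln (max 1 (cmod (f (of_real R * cis t)))) \<le> R powr \<rho>"
        by simp
    qed
  qed (use \<rho> in auto)
qed

lemma full_count_mono: "R \<le> S \<Longrightarrow> full_count f R \<le> full_count f S"
  unfolding full_count_def by (intro sum_mono2 finite_zeros_upto) (auto simp: zeros_upto_def)

text \<open>The count and coefficient estimates are fed with positive parts of size
  \<open>R powr \<rho>\<close>; the mean over the unit circle is a fixed number absorbed in
  \<open>C\<close>. The coefficient bound is uniform in \<open>l\<close>.\<close>

lemma growth_bounds:
  obtains \<rho> C where "0 < \<rho>" "\<rho> < 1" "C > 0" "\<And>R. R \<ge> 1 \<Longrightarrow> full_count f R \<le> C * R powr \<rho>"
    "\<forall>\<^sub>F R in at_top. \<forall>R' h l. log_cofactor f R R' h \<longrightarrow> l \<ge> 1 \<longrightarrow>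
        R ^ l * cmod ((deriv ^^ l) h 0 / fact l) \<le> C * R powr \<rho>"
proof -
  obtain \<rho> R0 where \<rho>: "0 < \<rho>" "\<rho> < 1" and R0: "R0 \<ge> 1"
    and P: "\<And>R. R \<ge> R0 \<Longrightarrow> circle_log_plus f R \<le> 2 * pi * R powr \<rho>"
    using circle_log_plus_growth by blast
  define L where "L = \<bar>circle_log f 1\<bar>"
  define C1 where "C1 = (4 * pi + L) / (2 * pi * ln 2)"
  have "L \<ge> 0"
    by (simp add: L_def)
  then have "C1 > 0"
    by (simp add: C1_def add_pos_nonneg)
  have ge1: "R powr \<rho> \<ge> 1" if "R \<ge> 1" for R
    using that \<rho> by (simp add: ge_one_powr_ge_zero)
  have N: "full_count f R \<le> C1 * R powr \<rho>" if "R \<ge> R0" for R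
  proof -
    have "2 * pi * ln 2 * full_count f R \<le> circle_log_plus f (2 * R) - circle_log f 1"
      using that R0 by (intro full_count_le) auto
    also have "\<dots> \<le> 2 * pi * (2 * R) powr \<rho> + L * 1"
      using P[of "2 * R"] that R0 by (simp add: L_def)
    also have "(2 * R) powr \<rho> = 2 powr \<rho> * R powr \<rho>"
      using that R0 by (simp add: powr_mult)
    also have "2 * pi * (2 powr \<rho> * R powr \<rho>) + L * 1 \<le> 2 * pi * (2 * R powr \<rho>) + L * R powr \<rho>"
    proof (intro add_mono mult_left_mono mult_right_mono)
      show "2 powr \<rho> \<le> 2"
        using powr_mono[of \<rho> 1 2] \<rho> by simp
    qed (use ge1[of R] that R0 \<open>L \<ge> 0\<close> in auto)
    finally have "2 * pi * ln 2 * full_count f R \<le> (4 * pi + L) * R powr \<rho>"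
      by (simp add: algebra_simps)
    then show ?thesis
      by (simp add: C1_def field_simps)
  qed
  \<comment> \<open>Adding the count at \<open>R0\<close> extends the bound to
    \<open>1 \<le> R < R0\<close>, where \<open>R powr \<rho> \<ge> 1\<close>.\<close>
  define C2 where "C2 = C1 + full_count f R0"
  define C3 where "C3 = 4 + L / pi + 4 * ln 2 * C1"
  define C where "C = C2 + C3"
  have C2: "C2 \<ge> C1" "C2 > 0"
    using full_count_nonneg[of R0] \<open>C1 > 0\<close> by (auto simp: C2_def)
  have "C3 > 0"
    using \<open>L \<ge> 0\<close> \<open>C1 > 0\<close> by (simp add: C3_def add_pos_nonneg)
  have fc: "full_count f R \<le> C * R powr \<rho>" if "R \<ge> 1" for R
  proof -
    have "full_count f R \<le> C2 * R powr \<rho>"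
    proof (cases "R \<ge> R0")
      case True
      then show ?thesis
        using N[OF True] C2 by (meson mult_right_mono order_trans powr_ge_zero)
    next
      case False
      have "full_count f R \<le> full_count f R0"
        using False by (intro full_count_mono) auto
      also have "\<dots> \<le> C2 * 1"
        using \<open>C1 > 0\<close> by (simp add: C2_def)
      also have "\<dots> \<le> C2 * R powr \<rho>"
        using ge1[OF that] C2 by (intro mult_left_mono) auto
      finally show ?thesis .
    qed
    also have "\<dots> \<le> C * R powr \<rho>"
      using \<open>C3 > 0\<close> by (intro mult_right_mono) (auto simp: C_def)
    finally show ?thesis .
  qed
  have co: "R ^ l * cmod ((deriv ^^ l) h 0 / fact l) \<le> C * R powr \<rho>"
    if "log_cofactor f R R' h" "l \<ge> 1" "R \<ge> R0" for R R' h l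
  proof -
    have "R \<ge> 1"
      using that R0 by simp
    then have "pi * R ^ l * cmod ((deriv ^^ l) h 0 / fact l)
        \<le> 2 * circle_log_plus f R - circle_log f R + 4 * pi * ln 2 * full_count f R"
      using that by (intro log_cofactor_coeff_le)
    also have "\<dots> \<le> 2 * (2 * pi * R powr \<rho>) + L * R powr \<rho> + 4 * pi * ln 2 * (C1 * R powr \<rho>)"
    proof (intro add_mono diff_mono mult_left_mono)
      have "- L * R powr \<rho> \<le> - L * 1"
        using ge1[OF \<open>R \<ge> 1\<close>] \<open>L \<ge> 0\<close> by (intro mult_left_mono_neg) auto
      also have "\<dots> \<le> circle_log f 1"
        by (simp add: L_def)
      also have "\<dots> \<le> circle_log f R"
        using \<open>R \<ge> 1\<close> by (intro circle_log_mono) auto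
      finally have "- circle_log f R \<le> L * R powr \<rho>"
        by simp
      moreover have "circle_log_plus f R \<le> 2 * pi * R powr \<rho>"
        using that by (intro P)
      ultimately show "2 * circle_log_plus f R - circle_log f R \<le> 2 * (2 * pi * R powr \<rho>) + L * R powr \<rho>"
        by linarith
    qed (use N[OF that(3)] in auto)
    also have "\<dots> = pi * (C3 * R powr \<rho>)"
      by (simp add: C3_def field_simps)
    finally have "pi * (R ^ l * cmod ((deriv ^^ l) h 0 / fact l)) \<le> pi * (C3 * R powr \<rho>)"
      by (simp add: mult.assoc)
    then have "R ^ l * cmod ((deriv ^^ l) h 0 / fact l) \<le> C3 * R powr \<rho>"
      by (rule mult_left_le_imp_le) simp
    also have "\<dots> \<le> C * R powr \<rho>"
      using C2 by (intro mult_right_mono) (auto simp: C_def)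
    finally show ?thesis .
  qed
  show ?thesis
  proof (rule that[OF \<rho> _ fc])
    show "C > 0"
      using C2 \<open>C3 > 0\<close> by (simp add: C_def)
    show "\<forall>\<^sub>F R in at_top. \<forall>R' h l. log_cofactor f R R' h \<longrightarrow> l \<ge> 1 \<longrightarrow>
        R ^ l * cmod ((deriv ^^ l) h 0 / fact l) \<le> C * R powr \<rho>"
      using eventually_ge_at_top[of R0] by eventually_elim (use co in blast)
  qed
qed

text \<open>The exponent satisfies \<open>\<rho> < 1 \<le> l\<close>, so \<open>R ^ l\<close>
  outgrows \<open>R powr \<rho>\<close>: once all zeros are divided out, no nonconstant exponential
  factor is left.\<close>

lemma log_cofactor_coeff_tendsto_0:
  assumes "\<And>n. log_cofactor f (real n) (S' n) (g n)" "l \<ge> 1"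
  shows "(\<lambda>n. (deriv ^^ l) (g n) 0 / fact l) \<longlonglongrightarrow> 0"
proof -
  obtain \<rho> C where \<rho>: "0 < \<rho>" "\<rho> < 1" "C > 0" and
    ev: "\<forall>\<^sub>F R in at_top. \<forall>R' h l. log_cofactor f R R' h \<longrightarrow> l \<ge> 1 \<longrightarrow>
        R ^ l * cmod ((deriv ^^ l) h 0 / fact l) \<le> C * R powr \<rho>"
    using growth_bounds by blast
  have lim: "(\<lambda>n. C * real n powr (\<rho> - 1)) \<longlonglongrightarrow> 0"
    using \<rho> by real_asymp
  show ?thesis
  proof (rule Lim_null_comparison[OF _ lim])
    show "\<forall>\<^sub>F n in sequentially. cmod ((deriv ^^ l) (g n) 0 / fact l) \<le> C * real n powr (\<rho> - 1)"
      using ev[THEN eventually_compose_filterlim, OF filterlim_real_sequentially] eventually_ge_at_top[of 1]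
    proof eventually_elim
      case (elim n)
      let ?c = "cmod ((deriv ^^ l) (g n) 0 / fact l)"
      have "real n ^ 1 * ?c \<le> real n ^ l * ?c"
        using elim(2) assms(2) by (intro mult_right_mono power_increasing) auto
      also have "\<dots> \<le> C * real n powr \<rho>"
        using elim assms by blast
      finally show ?case
        using elim(2) by (simp add: powr_diff field_simps)
    qed
  qed
qed

text \<open>Dyadic grouping: at most \<open>C * (2 ^ j) powr \<rho>\<close> zeros fall into group
  \<open>j\<close>, each of weight at most \<open>2 / 2 ^ j\<close>, so a geometric series of ratio
  \<open>2 powr (\<rho> - 1) < 1\<close> dominates.\<close>

lemma sum_inverse_zeros_le:
  obtains B where "\<And>F. finite F \<Longrightarrow> F \<subseteq> {z. f z = 0 \<and> cmod z \<ge> 1} \<Longrightarrow>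
    (\<Sum>\<zeta>\<in>F. real (zero_mult f \<zeta>) / cmod \<zeta>) \<le> B"
proof -
  obtain \<rho> C where \<rho>: "0 < \<rho>" "\<rho> < 1" "C > 0" and
    fc: "\<And>R. R \<ge> 1 \<Longrightarrow> full_count f R \<le> C * R powr \<rho>"
    using growth_bounds by metis
  define q where "q = 2 powr (\<rho> - 1)"
  have q: "0 < q" "q < 1"
    using \<rho> by (auto simp: q_def powr_less_one)
  show ?thesis
  proof (rule that)
    fix F assume F: "finite F" "F \<subseteq> {z. f z = 0 \<and> cmod z \<ge> 1}"
    have "\<exists>k. cmod \<zeta> \<le> 2 ^ k \<and> 2 ^ k \<le> 2 * cmod \<zeta>" if "\<zeta> \<in> F" for \<zeta>
    proof -
      define k where "k = (LEAST k. cmod \<zeta> \<le> 2 ^ k)"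
      have "\<exists>k. cmod \<zeta> \<le> 2 ^ k"
        by (metis less_imp_le one_less_numeral_iff real_arch_pow semiring_norm(76))
      then have 1: "cmod \<zeta> \<le> 2 ^ k"
        unfolding k_def by (rule LeastI_ex)
      have "2 ^ k \<le> 2 * cmod \<zeta>"
      proof (cases k)
        case 0
        then show ?thesis
          using F that by fastforce
      next
        case (Suc j)
        then have "\<not> cmod \<zeta> \<le> 2 ^ j"
          unfolding k_def by (intro not_less_Least) simp
        then show ?thesis
          using Suc by simp
      qed
      with 1 show ?thesis
        by blast
    qed
    then obtain k where k: "\<And>\<zeta>. \<zeta> \<in> F \<Longrightarrow> cmod \<zeta> \<le> 2 ^ k \<zeta> \<and> 2 ^ k \<zeta> \<le> 2 * cmod \<zeta>"
      by metis
    define K where "K = k ` F"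
    have "finite K"
      using F by (simp add: K_def)
    have "(\<Sum>\<zeta>\<in>F. real (zero_mult f \<zeta>) / cmod \<zeta>) \<le> (\<Sum>\<zeta>\<in>F. 2 * (real (zero_mult f \<zeta>) / 2 ^ k \<zeta>))"
    proof (rule sum_mono)
      fix \<zeta> assume \<zeta>: "\<zeta> \<in> F"
      then have "cmod \<zeta> \<ge> 1" "2 ^ k \<zeta> \<le> 2 * cmod \<zeta>"
        using F k by auto
      then have "2 / (2 * cmod \<zeta>) \<le> 2 / 2 ^ k \<zeta>"
        by (intro frac_le) auto
      then have "1 / cmod \<zeta> \<le> 2 / 2 ^ k \<zeta>"
        by simp
      then have "real (zero_mult f \<zeta>) * (1 / cmod \<zeta>) \<le> real (zero_mult f \<zeta>) * (2 / 2 ^ k \<zeta>)"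
        by (intro mult_left_mono) auto
      then show "real (zero_mult f \<zeta>) / cmod \<zeta> \<le> 2 * (real (zero_mult f \<zeta>) / 2 ^ k \<zeta>)"
        by (simp add: mult.commute)
    qed
    also have "\<dots> = (\<Sum>j\<in>K. \<Sum>\<zeta>\<in>{\<zeta>\<in>F. k \<zeta> = j}. 2 * (real (zero_mult f \<zeta>) / 2 ^ k \<zeta>))"
      using F \<open>finite K\<close> by (intro sum.group[symmetric]) (auto simp: K_def)
    also have "\<dots> \<le> (\<Sum>j\<in>K. 2 * C * q ^ j)"
    proof (rule sum_mono)
      fix j
      have "(\<Sum>\<zeta>\<in>{\<zeta>\<in>F. k \<zeta> = j}. real (zero_mult f \<zeta>)) \<le> full_count f (2 ^ j)"
        unfolding full_count_def using F k
        by (intro sum_mono2 finite_zeros_upto) (auto simp: zeros_upto_def)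
      also have "\<dots> \<le> C * (2 ^ j) powr \<rho>"
        by (intro fc) simp
      also have "(2 ^ j) powr \<rho> = q ^ j * 2 ^ j"
        by (simp add: q_def powr_powr powr_diff power_divide flip: powr_realpow)
           (simp add: powr_powr mult.commute)
      finally have *: "(\<Sum>\<zeta>\<in>{\<zeta>\<in>F. k \<zeta> = j}. real (zero_mult f \<zeta>)) \<le> C * (q ^ j * 2 ^ j)" .
      have "(\<Sum>\<zeta>\<in>{\<zeta>\<in>F. k \<zeta> = j}. 2 * (real (zero_mult f \<zeta>) / 2 ^ k \<zeta>)) =
          2 / 2 ^ j * (\<Sum>\<zeta>\<in>{\<zeta>\<in>F. k \<zeta> = j}. real (zero_mult f \<zeta>))"
        unfolding sum_distrib_left by (intro sum.cong) auto
      also have "\<dots> \<le> 2 / 2 ^ j * (C * (q ^ j * 2 ^ j))"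
        by (intro mult_left_mono *) auto
      also have "\<dots> = 2 * C * q ^ j"
        by simp
      finally show "(\<Sum>\<zeta>\<in>{\<zeta>\<in>F. k \<zeta> = j}. 2 * (real (zero_mult f \<zeta>) / 2 ^ k \<zeta>)) \<le> 2 * C * q ^ j" .
    qed
    also have "\<dots> = 2 * C * (\<Sum>j\<in>K. q ^ j)"
      by (simp add: sum_distrib_left)
    also have "\<dots> \<le> 2 * C * (\<Sum>j. q ^ j)"
      using q \<rho> \<open>finite K\<close> by (intro mult_left_mono sum_le_suminf summable_geometric) auto
    finally show "(\<Sum>\<zeta>\<in>F. real (zero_mult f \<zeta>) / cmod \<zeta>) \<le> 2 * C * (\<Sum>j. q ^ j)" .
  qed
qed

lemma abs_summable_zero_powers:
  assumes "l \<ge> 1"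
  shows "(\<lambda>\<zeta>. norm (of_nat (zero_mult f \<zeta>) * (1 / \<zeta> ^ l) :: complex)) summable_on {z. f z = 0 \<and> cmod z > R}"
proof -
  obtain B where B: "\<And>F. finite F \<Longrightarrow> F \<subseteq> {z. f z = 0 \<and> cmod z \<ge> 1} \<Longrightarrow>
    (\<Sum>\<zeta>\<in>F. real (zero_mult f \<zeta>) / cmod \<zeta>) \<le> B"
    using sum_inverse_zeros_le by blast
  have "(\<lambda>\<zeta>. norm (of_nat (zero_mult f \<zeta>) * (1 / \<zeta> ^ l) :: complex)) summable_on {z. f z = 0 \<and> cmod z \<ge> 1}"
  proof (rule nonneg_bdd_above_summable_on)
    show "bdd_above (sum (\<lambda>\<zeta>. norm (of_nat (zero_mult f \<zeta>) * (1 / \<zeta> ^ l) :: complex)) `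
        {F. F \<subseteq> {z. f z = 0 \<and> cmod z \<ge> 1} \<and> finite F})"
    proof (rule bdd_aboveI2)
      fix F assume "F \<in> {F. F \<subseteq> {z. f z = 0 \<and> cmod z \<ge> 1} \<and> finite F}"
      then have F: "finite F" "F \<subseteq> {z. f z = 0 \<and> cmod z \<ge> 1}"
        by auto
      have "(\<Sum>\<zeta>\<in>F. norm (of_nat (zero_mult f \<zeta>) * (1 / \<zeta> ^ l) :: complex)) \<le> (\<Sum>\<zeta>\<in>F. real (zero_mult f \<zeta>) / cmod \<zeta>)"
      proof (rule sum_mono)
        fix \<zeta> assume "\<zeta> \<in> F"
        then have "cmod \<zeta> \<ge> 1"
          using F by auto
        then have "cmod \<zeta> ^ 1 \<le> cmod \<zeta> ^ l"
          using assms by (intro power_increasing) auto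
        then have "real (zero_mult f \<zeta>) / cmod \<zeta> ^ l \<le> real (zero_mult f \<zeta>) / cmod \<zeta>"
          using \<open>cmod \<zeta> \<ge> 1\<close> by (intro frac_le) auto
        then show "norm (of_nat (zero_mult f \<zeta>) * (1 / \<zeta> ^ l) :: complex) \<le> real (zero_mult f \<zeta>) / cmod \<zeta>"
          by (simp add: norm_mult norm_divide norm_power)
      qed
      also have "\<dots> \<le> B"
        by (rule B[OF F])
      finally show "(\<Sum>\<zeta>\<in>F. norm (of_nat (zero_mult f \<zeta>) * (1 / \<zeta> ^ l) :: complex)) \<le> B" .
    qed
  qed auto
  moreover have "(\<lambda>\<zeta>. norm (of_nat (zero_mult f \<zeta>) * (1 / \<zeta> ^ l) :: complex)) summable_on zeros_upto f 1"
    by (intro summable_on_finite finite_zeros_upto)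
  ultimately have "(\<lambda>\<zeta>. norm (of_nat (zero_mult f \<zeta>) * (1 / \<zeta> ^ l) :: complex)) summable_on
      ({z. f z = 0 \<and> cmod z \<ge> 1} \<union> zeros_upto f 1)"
    by (rule summable_on_union)
  then show ?thesis
    by (rule summable_on_subset_banach) (auto simp: zeros_upto_def)
qed

text \<open>The cofactor at radius \<open>R\<close> is compared with those at radius
  \<open>n\<close>, whose coefficients vanish in the limit.\<close>

lemma zeros_between_tendsto_coeff:
  assumes h: "log_cofactor f R R' h" and "R > 0" "l \<ge> 1"
  shows "(\<lambda>n. \<Sum>\<zeta>\<in>zeros_upto f (real n) - zeros_upto f R. of_nat (zero_mult f \<zeta>) * (1 / \<zeta> ^ l))
    \<longlonglongrightarrow> - of_nat l * ((deriv ^^ l) h 0 / fact l)"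
proof -
  have "\<exists>S' g. log_cofactor f (real n) S' g" for n
    using exists_log_cofactor by blast
  then obtain S' g where g: "\<And>n. log_cofactor f (real n) (S' n) (g n)"
    by metis
  have "(\<lambda>n. of_nat l * ((deriv ^^ l) (g n) 0 / fact l - (deriv ^^ l) h 0 / fact l))
      \<longlonglongrightarrow> of_nat l * (0 - (deriv ^^ l) h 0 / fact l)"
    by (intro tendsto_intros log_cofactor_coeff_tendsto_0[OF g] assms)
  moreover have "\<forall>\<^sub>F n in sequentially. of_nat l * ((deriv ^^ l) (g n) 0 / fact l - (deriv ^^ l) h 0 / fact l) =
      (\<Sum>\<zeta>\<in>zeros_upto f (real n) - zeros_upto f R. of_nat (zero_mult f \<zeta>) * (1 / \<zeta> ^ l))"
    using eventually_ge_at_top[of "nat \<lceil>R\<rceil>"]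
  proof eventually_elim
    case (elim n)
    then have "R \<le> real n"
      by linarith
    from log_cofactor_coeff_diff[OF h g \<open>R > 0\<close> this \<open>l \<ge> 1\<close>] show ?case
      using \<open>l \<ge> 1\<close> by (simp add: field_simps)
  qed
  ultimately show ?thesis
    using Lim_transform_eventually by fastforce
qed

text \<open>Exhaustion by discs identifies the value; absolute summability makes it the unordered
  sum.\<close>

lemma infsum_zero_powers:
  assumes h: "log_cofactor f R R' h" and "R > 0" "l \<ge> 1"
  shows "(\<Sum>\<^sub>\<infinity>\<zeta>\<in>{z. f z = 0 \<and> cmod z > R}. of_nat (zero_mult f \<zeta>) * (1 / \<zeta> ^ l)) =
    - of_nat l * ((deriv ^^ l) h 0 / fact l)"
proof -
  let ?A = "{z. f z = 0 \<and> cmod z > R}"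
  let ?g = "\<lambda>\<zeta>. of_nat (zero_mult f \<zeta>) * (1 / \<zeta> ^ l) :: complex"
  have "filterlim (\<lambda>n. zeros_upto f (real n) - zeros_upto f R) (finite_subsets_at_top ?A) sequentially"
    unfolding filterlim_finite_subsets_at_top
  proof (intro allI impI)
    fix X assume X: "finite X \<and> X \<subseteq> ?A"
    obtain n0 where n0: "\<And>z. z \<in> X \<Longrightarrow> cmod z \<le> real n0"
    proof -
      obtain n0 where "Max (insert 0 (cmod ` X)) \<le> real n0"
        using real_arch_simple by blast
      then show ?thesis
        using X by (intro that[of n0]) auto
    qed
    show "\<forall>\<^sub>F n in sequentially. finite (zeros_upto f (real n) - zeros_upto f R) \<and>
        X \<subseteq> zeros_upto f (real n) - zeros_upto f R \<and> zeros_upto f (real n) - zeros_upto f R \<subseteq> ?A"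
      using eventually_ge_at_top[of n0]
    proof eventually_elim
      case (elim n)
      have "cmod z \<le> real n" if "z \<in> X" for z
        using n0[OF that] elim by linarith
      then show ?case
        using X by (intro conjI finite_Diff finite_zeros_upto) (auto simp: zeros_upto_def)
    qed
  qed
  moreover have "(sum ?g \<longlongrightarrow> infsum ?g ?A) (finite_subsets_at_top ?A)"
    using has_sum_infsum[OF abs_summable_summable[OF abs_summable_zero_powers[OF \<open>l \<ge> 1\<close>]]]
    by (simp add: has_sum_def)
  ultimately have "(\<lambda>n. sum ?g (zeros_upto f (real n) - zeros_upto f R)) \<longlonglongrightarrow> infsum ?g ?A"
    by (rule filterlim_compose[rotated])
  with zeros_between_tendsto_coeff[OF assms] show ?thesis
    using LIMSEQ_unique by blast
qed

text \<open>The cofactor has lost the zeros with \<open>cmod z = R\<close>, but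
  \<open>tail_sum\<close> includes them; they account for the second summand.\<close>

lemma cmod_tail_sum_le:
  assumes h: "log_cofactor f R R' h" and "R > 0" "l \<ge> 1"
  shows "cmod (tail_sum f l R) \<le> real l * cmod ((deriv ^^ l) h 0 / fact l) + full_count f R / R ^ l"
proof -
  let ?A = "{z. f z = 0 \<and> cmod z > R}"
  let ?B = "{z. f z = 0 \<and> cmod z = R}"
  let ?g = "\<lambda>\<zeta>. of_nat (zero_mult f \<zeta>) * (1 / \<zeta> ^ l) :: complex"
  have "?B \<subseteq> zeros_upto f R"
    by (auto simp: zeros_upto_def)
  then have fin: "finite ?B"
    using finite_zeros_upto finite_subset by blast
  have "{z \<in> nonzero_zeros f. cmod z \<ge> R} = ?A \<union> ?B"
    using \<open>R > 0\<close> by (auto simp: nonzero_zeros_def)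
  then have "tail_sum f l R = infsum ?g (?A \<union> ?B)"
    by (simp add: tail_sum_def)
  also have "\<dots> = infsum ?g ?A + infsum ?g ?B"
    using fin by (intro infsum_Un_disjoint abs_summable_summable[OF abs_summable_zero_powers[OF \<open>l \<ge> 1\<close>]]) auto
  also have "infsum ?g ?B = sum ?g ?B"
    using fin by simp
  finally have eq: "tail_sum f l R = - of_nat l * ((deriv ^^ l) h 0 / fact l) + sum ?g ?B"
    unfolding infsum_zero_powers[OF assms] .
  have "cmod (tail_sum f l R) \<le> cmod (- of_nat l * ((deriv ^^ l) h 0 / fact l)) + cmod (sum ?g ?B)"
    unfolding eq by (rule norm_triangle_ineq)
  moreover have "cmod (sum ?g ?B) \<le> (\<Sum>\<zeta>\<in>?B. real (zero_mult f \<zeta>) / R ^ l)"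
    by (rule sum_norm_le) (simp add: norm_mult norm_divide norm_power)
  moreover have "\<dots> \<le> (\<Sum>\<zeta>\<in>zeros_upto f R. real (zero_mult f \<zeta>) / R ^ l)"
    using \<open>?B \<subseteq> _\<close> \<open>R > 0\<close> by (intro sum_mono2 finite_zeros_upto) auto
  moreover have "\<dots> = full_count f R / R ^ l"
    by (simp add: full_count_def sum_divide_distrib)
  moreover have "cmod (- of_nat l * ((deriv ^^ l) h 0 / fact l)) = real l * cmod ((deriv ^^ l) h 0 / fact l)"
    by (simp only: norm_mult norm_minus_cancel norm_of_nat)
  ultimately show ?thesis
    by linarith
qed

end

section \<open>From pointwise to locally uniform bounds\<close>

lemma sum_roots_of_unity_eq_0:
  fixes j :: int
  assumes "K > 0" "\<not> int K dvd j"
  shows "(\<Sum>i<K. cis (2 * pi * real i * of_int j / real K)) = 0"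
proof -
  define x where "x = cis (2 * pi * of_int j / real K)"
  have pow: "cis (2 * pi * real i * of_int j / real K) = x ^ i" for i
    by (simp add: x_def Complex.DeMoivre mult_ac)
  have "x ^ K = 1"
    using assms(1) by (simp add: x_def Complex.DeMoivre)
  moreover have "x \<noteq> 1"
  proof
    assume "x = 1"
    then have "cos (2 * pi * of_int j / real K) = 1"
      unfolding x_def by (metis cis.sel(1) one_complex.sel(1))
    then obtain y :: int where "2 * pi * of_int j / real K = of_int y * (2 * pi)"
      using cos_one_2pi_int by auto
    then have "of_int j = (of_int (y * int K) :: real)"
      using assms(1) by (simp add: field_simps)
    then have "j = y * int K"
      by (rule of_int_eq_iff[THEN iffD1])
    with assms(2) show False
      by simp
  qed
  ultimately have "(\<Sum>i<K. x ^ i) = 0"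
    using geometric_sum[of x K] by simp
  then show ?thesis
    by (simp add: pow)
qed

text \<open>A trigonometric polynomial without constant term has mean \<open>0\<close> over the roots of unity, so a
  one-sided bound on its real part there is an \<open>L\<^sup>1\<close> bound, hence a bound on its coefficients.\<close>

lemma trig_poly_one_sided_bound:
  fixes a :: "nat \<Rightarrow> complex" and m :: nat
  defines "q \<equiv> \<lambda>i. \<Sum>l\<in>{1..<m}. a l * cis (2 * pi * real i * real l / real (2 * m))"
  assumes "m \<ge> 1"
  shows "(\<Sum>i<2*m. Re (q i)) = 0"
    and "(\<And>i. i < 2 * m \<Longrightarrow> Re (q i) \<le> b) \<Longrightarrow> l \<in> {1..<m} \<Longrightarrow> cmod (a l) \<le> 4 * b"
proof -
  \<comment> \<open>All sums and differences of two frequencies from \<open>{1..<m}\<close> are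
    smaller than \<open>K\<close> in modulus, so orthogonality over the K-th roots of unity applies
    to them and to the conjugates.\<close>
  define K where "K = 2 * m"
  have K: "K > 0"
    using assms by (simp add: K_def)
  have root: "(\<Sum>i<K. cis (2 * pi * real i * of_int j / real K)) = 0" if "j \<noteq> 0" "\<bar>j\<bar> < int K" for j
    using dvd_imp_le_int[of j "int K"] that K by (intro sum_roots_of_unity_eq_0) auto
  have q: "q i = (\<Sum>l\<in>{1..<m}. a l * cis (2 * pi * real i * of_int (int l) / real K))" for i
    by (simp add: q_def K_def)
  have "(\<Sum>i<K. q i) = (\<Sum>l\<in>{1..<m}. a l * (\<Sum>i<K. cis (2 * pi * real i * of_int (int l) / real K)))"
    unfolding q sum_distrib_left by (rule sum.swap)
  also have "\<dots> = 0"
    by (intro sum.neutral ballI, subst root) (auto simp: K_def)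
  finally have q0: "(\<Sum>i<K. q i) = 0" .
  then show Re0: "(\<Sum>i<2*m. Re (q i)) = 0"
    by (metis K_def Re_sum zero_complex.sel(1))
  assume le: "\<And>i. i < 2 * m \<Longrightarrow> Re (q i) \<le> b" and l: "l \<in> {1..<m}"
  have "(\<Sum>i<2*m. Re (q i)) \<le> (\<Sum>i<2*m. b)"
    by (intro sum_mono le) auto
  then have "b \<ge> 0"
    using Re0 \<open>m \<ge> 1\<close> by (simp add: zero_le_mult_iff)
  \<comment> \<open>Discrete version of the passage from an upper bound and mean 0 to an L1
    bound.\<close>
  have "(\<Sum>i<K. \<bar>Re (q i)\<bar>) \<le> (\<Sum>i<K. 2 * b - Re (q i))"
  proof (rule sum_mono)
    fix i assume "i \<in> {..<K}"
    then show "\<bar>Re (q i)\<bar> \<le> 2 * b - Re (q i)"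
      using le[of i] \<open>b \<ge> 0\<close> by (auto simp: K_def)
  qed
  also have "\<dots> = 2 * real K * b"
    using Re0 by (simp add: sum_subtractf K_def)
  finally have L1: "(\<Sum>i<K. \<bar>Re (q i)\<bar>) \<le> 2 * real K * b" .
  have cis_add: "cis (2 * pi * real i * of_int x / real K) * cis (2 * pi * real i * of_int y / real K)
      = cis (2 * pi * real i * of_int (x + y) / real K)" for i x y
    by (simp add: cis_mult add_divide_distrib distrib_left)
  have 1: "(\<Sum>i<K. q i * cis (2 * pi * real i * of_int (- int l) / real K)) = of_nat K * a l"
  proof -
    have "(\<Sum>i<K. q i * cis (2 * pi * real i * of_int (- int l) / real K))
        = (\<Sum>i<K. \<Sum>l'\<in>{1..<m}. a l' * cis (2 * pi * real i * of_int (int l' + - int l) / real K))"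
      unfolding q sum_distrib_right
      by (intro sum.cong refl, subst cis_add[symmetric]) (rule mult.assoc)
    also have "\<dots> = (\<Sum>l'\<in>{1..<m}. a l' * (\<Sum>i<K. cis (2 * pi * real i * of_int (int l' + - int l) / real K)))"
      unfolding sum_distrib_left by (rule sum.swap)
    also have "\<dots> = (\<Sum>l'\<in>{1..<m}. if l' = l then of_nat K * a l else 0)"
    proof (intro sum.cong refl)
      fix l' assume l': "l' \<in> {1..<m}"
      show "a l' * (\<Sum>i<K. cis (2 * pi * real i * of_int (int l' + - int l) / real K)) =
          (if l' = l then of_nat K * a l else 0)"
      proof (cases "l' = l")
        case False
        then show ?thesis
          using l l' by (subst root) (auto simp: K_def)
      qed simp
    qed
    also have "\<dots> = of_nat K * a l"
      using l by simp
    finally show ?thesis .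
  qed
  have 2: "(\<Sum>i<K. cnj (q i) * cis (2 * pi * real i * of_int (- int l) / real K)) = 0"
  proof -
    have cq: "cnj (q i) = (\<Sum>l'\<in>{1..<m}. cnj (a l') * cis (2 * pi * real i * of_int (- int l') / real K))" for i
      unfolding q cnj_sum complex_cnj_mult cis_cnj by simp
    have "(\<Sum>i<K. cnj (q i) * cis (2 * pi * real i * of_int (- int l) / real K))
        = (\<Sum>i<K. \<Sum>l'\<in>{1..<m}. cnj (a l') * cis (2 * pi * real i * of_int (- int l' + - int l) / real K))"
      unfolding cq sum_distrib_right
      by (intro sum.cong refl, subst cis_add[symmetric]) (rule mult.assoc)
    also have "\<dots> = (\<Sum>l'\<in>{1..<m}. cnj (a l') * (\<Sum>i<K. cis (2 * pi * real i * of_int (- int l' + - int l) / real K)))"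
      unfolding sum_distrib_left by (rule sum.swap)
    also have "\<dots> = 0"
      by (intro sum.neutral ballI, subst root) (use l in \<open>auto simp: K_def\<close>)
    finally show ?thesis .
  qed
  have "of_nat K * a l = (\<Sum>i<K. (q i + cnj (q i)) * cis (2 * pi * real i * of_int (- int l) / real K))"
    using 1 2 by (simp only: distrib_right sum.distrib add_0_right)
  also have "cmod \<dots> \<le> (\<Sum>i<K. 2 * \<bar>Re (q i)\<bar>)"
    by (rule sum_norm_le) (simp add: norm_mult complex_add_cnj)
  also have "\<dots> \<le> 2 * (2 * real K * b)"
    unfolding sum_distrib_left[symmetric] using L1 by (intro mult_left_mono) auto
  finally have "real K * cmod (a l) \<le> real K * (4 * b)"
    by (simp add: norm_mult)
  then show "cmod (a l) \<le> 4 * b"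
    using K by simp
qed

text \<open>On the circle \<open>\<bar>z - z0\<bar> = \<epsilon>\<close> the product agrees in absolute value with that of the factors
  \<open>\<epsilon> - u (a i - z0)\<close>, \<open>\<bar>u\<bar> = 1\<close>, to which the maximum principle at \<open>u = 0\<close> applies.\<close>

lemma exists_large_prod_linear_factors:
  fixes a :: "'i \<Rightarrow> complex" and \<mu> :: "'i \<Rightarrow> nat"
  assumes "finite A" "\<epsilon> > 0"
  obtains z where "z \<in> cball z0 \<epsilon>" "(\<Prod>i\<in>A. cmod (z - a i) ^ \<mu> i) \<ge> \<epsilon> ^ (\<Sum>i\<in>A. \<mu> i)"
proof (rule ccontr)
  assume neg: "\<not> thesis"
  note thesisI = that
  define g where "g u = (\<Prod>i\<in>A. (of_real \<epsilon> - u * (a i - z0)) ^ \<mu> i)" for u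
  have small: "cmod (g u) < \<epsilon> ^ (\<Sum>i\<in>A. \<mu> i)" if "cmod u = 1" for u
  proof -
    define z where "z = z0 + of_real \<epsilon> * cnj u"
    have u: "u * cnj u = 1"
      using that by (simp add: complex_norm_square[symmetric])
    have "cmod (z - a i) = cmod (of_real \<epsilon> - u * (a i - z0))" for i
    proof -
      have "cmod (z - a i) = cmod (u * (z - a i))"
        using that by (simp add: norm_mult)
      also have "u * (z - a i) = of_real \<epsilon> * (u * cnj u) - u * (a i - z0)"
        by (simp add: z_def algebra_simps)
      finally show ?thesis
        by (simp add: u)
    qed
    then have "cmod (g u) = (\<Prod>i\<in>A. cmod (z - a i) ^ \<mu> i)"
      by (simp add: g_def norm_power flip: prod_norm)
    moreover have "z \<in> cball z0 \<epsilon>"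
      using that \<open>\<epsilon> > 0\<close> by (simp add: z_def dist_norm norm_mult)
    ultimately show ?thesis
      using neg thesisI[of z] by (cases "cmod (g u) < \<epsilon> ^ sum \<mu> A") auto
  qed
  \<comment> \<open>The maximum over the sphere is attained, so the strict inequality
    \<open>small\<close> applies to the maximum itself.\<close>
  obtain u where u: "u \<in> sphere 0 1" "\<And>v. v \<in> sphere 0 1 \<Longrightarrow> cmod (g v) \<le> cmod (g u)"
  proof -
    have "continuous_on (sphere 0 1) (\<lambda>u. cmod (g u))"
      unfolding g_def by (intro continuous_intros)
    moreover have "(1::complex) \<in> sphere 0 1"
      by simp
    ultimately have "\<exists>u\<in>sphere 0 1. \<forall>v\<in>sphere 0 1. cmod (g v) \<le> cmod (g u)"
      by (intro continuous_attains_sup) auto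
    then show ?thesis
      using that by blast
  qed
  have "cmod (g 0) \<le> cmod (g u)"
  proof (rule maximum_modulus_frontier[of g "cball 0 1"])
    show "g holomorphic_on interior (cball 0 1)"
      unfolding g_def by (intro holomorphic_intros)
    show "continuous_on (closure (cball 0 1)) g"
      unfolding g_def by (intro continuous_intros)
    show "cmod (g v) \<le> cmod (g u)" if "v \<in> frontier (cball 0 1)" for v
      using that by (intro u(2)) (simp add: frontier_cball)
  qed auto
  moreover have "cmod (g 0) = \<epsilon> ^ (\<Sum>i\<in>A. \<mu> i)"
    using \<open>\<epsilon> > 0\<close> by (simp add: g_def power_sum norm_power flip: prod_norm)
  ultimately show False
    using small[of u] u(1) by simp
qed

text \<open>Meant for a Taylor series at half the radius: if
  \<open>R ^ l * cmod (c l) \<le> X\<close>, the terms at points of modulus at most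
  \<open>R / 2\<close> are at most \<open>X / 2 ^ l\<close>.\<close>

lemma sums_tail_bound:
  fixes a :: "nat \<Rightarrow> complex"
  assumes "a sums s" and le: "\<And>l. l \<ge> m \<Longrightarrow> cmod (a l) \<le> X / 2 ^ l" and "X \<ge> 0"
  shows "cmod (s - (\<Sum>l<m. a l)) \<le> 2 * X"
proof -
  have 1: "(\<lambda>l. a (l + m)) sums (s - (\<Sum>l<m. a l))"
    using assms(1) by (simp add: sums_iff_shift)
  have 2: "(\<lambda>l. X * (1/2) ^ l) sums (X * (1 / (1 - 1/2)))"
    by (intro sums_mult geometric_sums) auto
  have le': "cmod (a (l + m)) \<le> X * (1/2) ^ l" for l
  proof -
    have "cmod (a (l + m)) \<le> X / 2 ^ (l + m)"
      by (rule le) simp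
    also have "\<dots> \<le> X / 2 ^ l"
      using \<open>X \<ge> 0\<close> by (intro divide_left_mono power_increasing) auto
    finally show ?thesis
      by (simp add: power_divide)
  qed
  have "cmod (\<Sum>l. a (l + m)) \<le> (\<Sum>l. X * (1/2) ^ l)"
    using le' sums_summable[OF 2] by (rule norm_suminf_le)
  then show ?thesis
    using sums_unique[OF 1] sums_unique[OF 2] by simp
qed

section \<open>Consequences of a bound on one absolute tail sum\<close>

lemma sum_le_abs_tail_sum:
  assumes "finite F" "F \<subseteq> {z \<in> nonzero_zeros f. cmod z \<ge> R0}" "abs_tail_sum f m R0 \<le> ennreal S" "S \<ge> 0"
  shows "(\<Sum>\<zeta>\<in>F. real (zero_mult f \<zeta>) / cmod \<zeta> ^ m) \<le> S"
proof -
  have "ennreal (\<Sum>\<zeta>\<in>F. real (zero_mult f \<zeta>) / cmod \<zeta> ^ m)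
      = (\<Sum>\<zeta>\<in>F. ennreal (real (zero_mult f \<zeta>) * (1 / cmod \<zeta> ^ m)))"
    by simp
  also have "\<dots> = (\<Sum>\<zeta>\<in>F. of_nat (zero_mult f \<zeta>) * ennreal (1 / cmod \<zeta> ^ m))"
    by (intro sum.cong refl, subst ennreal_mult) (auto simp: ennreal_of_nat_eq_real_of_nat)
  also have "\<dots> \<le> abs_tail_sum f m R0"
    unfolding abs_tail_sum_def using assms(1,2)
    by (subst nonneg_infsum_complete) (auto intro!: SUP_upper)
  also note assms(3)
  finally show ?thesis
    using \<open>S \<ge> 0\<close> by simp
qed

text \<open>Each zero counted satisfies \<open>1 \<le> (R / cmod \<zeta>) ^ m\<close>, so the m-th
  power sum dominates the count.\<close>

lemma (in nonzero_entire) zeros_between_count_le: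
  assumes "0 < R0" "R0 \<le> R" "abs_tail_sum f m R0 \<le> ennreal S" "S \<ge> 0"
  shows "(\<Sum>\<zeta>\<in>{\<zeta>\<in>zeros_upto f R. cmod \<zeta> \<ge> R0}. real (zero_mult f \<zeta>)) \<le> R ^ m * S"
proof -
  let ?F = "{\<zeta>\<in>zeros_upto f R. cmod \<zeta> \<ge> R0}"
  have fin: "finite ?F"
    by (rule finite_subset[OF _ finite_zeros_upto[of R]]) auto
  have "(\<Sum>\<zeta>\<in>?F. real (zero_mult f \<zeta>)) \<le> (\<Sum>\<zeta>\<in>?F. R ^ m * (real (zero_mult f \<zeta>) / cmod \<zeta> ^ m))"
  proof (rule sum_mono)
    fix \<zeta> assume "\<zeta> \<in> ?F"
    then have \<zeta>: "cmod \<zeta> > 0" "cmod \<zeta> \<le> R"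
      using assms by (auto simp: zeros_upto_def)
    then have "1 \<le> R ^ m / cmod \<zeta> ^ m"
      by (simp add: power_mono)
    then have "real (zero_mult f \<zeta>) * 1 \<le> real (zero_mult f \<zeta>) * (R ^ m / cmod \<zeta> ^ m)"
      by (intro mult_left_mono) auto
    then show "real (zero_mult f \<zeta>) \<le> R ^ m * (real (zero_mult f \<zeta>) / cmod \<zeta> ^ m)"
      by (simp add: mult.commute)
  qed
  also have "\<dots> = R ^ m * (\<Sum>\<zeta>\<in>?F. real (zero_mult f \<zeta>) / cmod \<zeta> ^ m)"
    by (simp add: sum_distrib_left)
  also have "\<dots> \<le> R ^ m * S"
    using assms
    by (intro mult_left_mono sum_le_abs_tail_sum[OF fin _ assms(3)]) (auto simp: zeros_upto_def nonzero_zeros_def)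
  finally show ?thesis .
qed

text \<open>Up to the factor -1/l the coefficient is a power sum over zeros beyond \<open>R\<close>,
  where \<open>cmod \<zeta> ^ l \<ge> cmod \<zeta> ^ m * R ^ (l - m)\<close>. This works only for
  \<open>m \<le> l\<close>; lower degrees need the averaging argument.\<close>

lemma (in genus_zero_entire) log_cofactor_coeff_le_tail:
  assumes h: "log_cofactor f R R' h" and R: "0 < R0" "R0 \<le> R"
    and S: "abs_tail_sum f m R0 \<le> ennreal S" "S \<ge> 0" and l: "1 \<le> m" "m \<le> l"
  shows "R ^ l * cmod ((deriv ^^ l) h 0 / fact l) \<le> R ^ m * S"
proof -
  let ?s = "\<lambda>n. \<Sum>\<zeta>\<in>zeros_upto f (real n) - zeros_upto f R. of_nat (zero_mult f \<zeta>) * (1 / \<zeta> ^ l)"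
  have bound: "cmod (?s n) \<le> S / R ^ (l - m)" for n
  proof -
    let ?F = "zeros_upto f (real n) - zeros_upto f R"
    have "cmod (?s n) \<le> (\<Sum>\<zeta>\<in>?F. (real (zero_mult f \<zeta>) / cmod \<zeta> ^ m) / R ^ (l - m))"
    proof (rule sum_norm_le)
      fix \<zeta> assume "\<zeta> \<in> ?F"
      then have \<zeta>: "cmod \<zeta> > R" "cmod \<zeta> > 0"
        using R by (auto simp: zeros_upto_def)
      have "cmod (of_nat (zero_mult f \<zeta>) * (1 / \<zeta> ^ l)) = real (zero_mult f \<zeta>) / cmod \<zeta> ^ (m + (l - m))"
        using l by (simp add: norm_mult norm_divide norm_power)
      also have "\<dots> = (real (zero_mult f \<zeta>) / cmod \<zeta> ^ m) / cmod \<zeta> ^ (l - m)"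
        by (simp add: power_add)
      also have "\<dots> \<le> (real (zero_mult f \<zeta>) / cmod \<zeta> ^ m) / R ^ (l - m)"
        using \<zeta> R by (intro frac_le power_mono) auto
      finally show "cmod (of_nat (zero_mult f \<zeta>) * (1 / \<zeta> ^ l)) \<le> (real (zero_mult f \<zeta>) / cmod \<zeta> ^ m) / R ^ (l - m)" .
    qed
    also have "\<dots> = (\<Sum>\<zeta>\<in>?F. real (zero_mult f \<zeta>) / cmod \<zeta> ^ m) / R ^ (l - m)"
      by (simp add: sum_divide_distrib)
    also have "\<dots> \<le> S / R ^ (l - m)"
      using R
      by (intro divide_right_mono sum_le_abs_tail_sum[OF finite_Diff[OF finite_zeros_upto] _ S]) (auto simp: zeros_upto_def nonzero_zeros_def)
    finally show ?thesis .
  qed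
  have "(\<lambda>n. cmod (?s n)) \<longlonglongrightarrow> cmod (- of_nat l * ((deriv ^^ l) h 0 / fact l))"
    using l R by (intro tendsto_norm zeros_between_tendsto_coeff[OF h]) auto
  then have "cmod (- of_nat l * ((deriv ^^ l) h 0 / fact l)) \<le> S / R ^ (l - m)"
    by (rule LIMSEQ_le_const2) (use bound in auto)
  then have "real l * cmod ((deriv ^^ l) h 0 / fact l) \<le> S / R ^ (l - m)"
    by (simp only: norm_mult norm_minus_cancel norm_of_nat)
  moreover have "1 * cmod ((deriv ^^ l) h 0 / fact l) \<le> real l * cmod ((deriv ^^ l) h 0 / fact l)"
    using l by (intro mult_right_mono) auto
  ultimately have "cmod ((deriv ^^ l) h 0 / fact l) \<le> S / R ^ (l - m)"
    by linarith
  then have "R ^ l * cmod ((deriv ^^ l) h 0 / fact l) \<le> R ^ l * (S / R ^ (l - m))"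
    using R by (intro mult_left_mono) auto
  also have "R ^ l * (S / R ^ (l - m)) = R ^ m * S"
  proof -
    have "R ^ l = R ^ m * R ^ (l - m)"
      using l by (simp flip: power_add)
    then show ?thesis
      using R by simp
  qed
  finally show ?thesis .
qed

text \<open>On a small disc well outside the zeros of modulus \<open>< R0\<close>, averaging
  \<open>ln \<bar>f\<bar>\<close> over rotations by roots of unity removes the polynomial part of \<open>Re h\<close> of degree
  \<open>< m\<close>, which nothing controls a priori. The lower bound on the mean of \<open>ln \<bar>f\<bar>\<close> over the unit
  circle then bounds first the number of zeros of modulus \<open>< R0\<close>, then \<open>Re (h 0)\<close>, then that polynomial.\<close>

lemma (in genus_zero_entire) local_bound_core:
  fixes m :: nat and R0 R A B0 M \<epsilon> \<rho> \<kappa> :: real and z0 :: complex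
  defines "K \<equiv> 2 * m"
  defines "n' \<equiv> R ^ m * B0"
  defines "B1 \<equiv> M + A + 2 * n' + n' * (ln (1 + R) - ln \<epsilon>)"
  defines "B2 \<equiv> M + 2 * n' - n' * ln \<epsilon>"
  defines "B3 \<equiv> A + B1 * ln (1 + R0) + n' * ln (1 + R)"
  defines "B4 \<equiv> M + 2 * n' + B3 + real K * n' * (ln (2 * R) - ln \<epsilon>)"
  assumes m: "m \<ge> 1" and \<kappa>: "\<kappa> > 0" and B0: "B0 \<ge> 0" and R0: "1 \<le> R0" "R0 \<le> R" and \<rho>: "0 \<le> \<rho>" "\<rho> \<le> R / 2"
    and \<epsilon>: "0 < \<epsilon>" "\<epsilon> \<le> 1"
    and tail: "abs_tail_sum f m R0 \<le> ennreal (B0 * \<kappa>)"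
    and mean: "circle_log f 1 \<ge> - 2 * pi * A * \<kappa>"
    and disc: "\<And>z. z \<in> cball z0 \<epsilon> \<Longrightarrow> R0 + exp 1 * (1 + R0) \<le> cmod z \<and> cmod z \<le> R / 2"
    and bound: "\<And>z i. z \<in> cball z0 \<epsilon> \<Longrightarrow> i < 2 * m \<Longrightarrow> cmod (f (cis (2 * pi * real i / real (2 * m)) * z)) \<le> exp (M * \<kappa>)"
    and w: "cmod w \<le> \<rho>"
  shows "cmod (f w) \<le> exp (((B1 + n') * ln (2 * R) + B2 + 4 * B4 * (\<Sum>l\<in>{1..<m}. \<rho> ^ l) + 2 * n') * \<kappa>)"
proof -
  obtain R' h where h: "log_cofactor f R R' h"
    by (rule exists_log_cofactor)
  then have h': "h holomorphic_on ball 0 R'" "R < R'"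
    by (auto simp: log_cofactor_def)
  \<comment> \<open>\<open>I\<close> holds the inner zeros, of which nothing is known yet, and
    \<open>J\<close> those counted by the tail sum. In units of \<open>\<kappa>\<close>,
    \<open>n'\<close> bounds \<open>N'\<close>, while \<open>B1\<close>, \<open>B2\<close>,
    \<open>B3\<close>, \<open>B4\<close> bound \<open>N\<close>, \<open>Re (h 0)\<close>,
    \<open>- Re (h 0)\<close> and the real part of \<open>p\<close> at the rotated points.\<close>
  define I where "I = {\<zeta>\<in>zeros_upto f R. cmod \<zeta> < R0}"
  define J where "J = {\<zeta>\<in>zeros_upto f R. cmod \<zeta> \<ge> R0}"
  define \<mu> where "\<mu> \<zeta> = real (zero_mult f \<zeta>)" for \<zeta>
  define N where "N = (\<Sum>\<zeta>\<in>I. \<mu> \<zeta>)"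
  define N' where "N' = (\<Sum>\<zeta>\<in>J. \<mu> \<zeta>)"
  define c where "c l = (deriv ^^ l) h 0 / fact l" for l
  define p where "p z = (\<Sum>l\<in>{1..<m}. c l * z ^ l)" for z
  define \<omega> where "\<omega> i = cis (2 * pi * real i / real K)" for i
  have fin: "finite I" "finite J"
    by (auto simp: I_def J_def finite_zeros_upto)
  have IJ: "zeros_upto f R = I \<union> J" "I \<inter> J = {}"
    by (auto simp: I_def J_def)
  have \<mu>0: "\<mu> \<zeta> \<ge> 0" for \<zeta>
    by (simp add: \<mu>_def)
  have N0: "N \<ge> 0" "N' \<ge> 0"
    unfolding N_def N'_def by (auto intro: sum_nonneg simp: \<mu>0)
  have R1: "R \<ge> 1"
    using R0 by simp
  have n'0: "n' \<ge> 0"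
    using B0 R1 by (simp add: n'_def)
  have S0: "B0 * \<kappa> \<ge> 0"
    using B0 \<kappa> by simp
  have N'_le: "N' \<le> n' * \<kappa>"
    using zeros_between_count_le[OF _ R0(2) tail S0] R0 by (simp add: N'_def J_def \<mu>_def n'_def)
  have ln_\<epsilon>: "ln \<epsilon> \<le> 0"
    using \<epsilon> by simp
  have lnf: "ln (cmod (f z)) = (\<Sum>\<zeta>\<in>I. \<mu> \<zeta> * ln (cmod (z - \<zeta>))) + (\<Sum>\<zeta>\<in>J. \<mu> \<zeta> * ln (cmod (z - \<zeta>))) + Re (h z)"
    if "cmod z \<le> R" "f z \<noteq> 0" for z
    using ln_cmod_log_cofactor[OF h, of z] that h'(2) fin IJ
    by (simp add: \<mu>_def sum.union_disjoint)
  \<comment> \<open>At half the radius the degrees from \<open>m\<close> on form a geometric series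
    of ratio 1/2; only \<open>h 0\<close> and \<open>p\<close> remain.\<close>
  have hz: "\<bar>Re (h z) - Re (h 0) - Re (p z)\<bar> \<le> 2 * n' * \<kappa>" if z: "cmod z \<le> R / 2" for z
  proof -
    have "(\<lambda>l. c l * (z - 0) ^ l) sums h z"
      unfolding c_def using z h'(2) R1 by (intro holomorphic_power_series[OF h'(1)]) auto
    then have "cmod (h z - (\<Sum>l<m. c l * (z - 0) ^ l)) \<le> 2 * (n' * \<kappa>)"
    proof (rule sums_tail_bound)
      fix l assume l: "m \<le> l"
      have "cmod (c l * (z - 0) ^ l) = cmod (c l) * cmod z ^ l"
        by (simp add: norm_mult norm_power)
      also have "\<dots> \<le> cmod (c l) * (R / 2) ^ l"
        using z by (intro mult_left_mono power_mono) auto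
      also have "\<dots> = R ^ l * cmod (c l) / 2 ^ l"
        by (simp add: power_divide)
      also have "\<dots> \<le> R ^ m * (B0 * \<kappa>) / 2 ^ l"
        unfolding c_def using R0 m l
        by (intro divide_right_mono log_cofactor_coeff_le_tail[OF h _ _ tail S0]) auto
      finally show "cmod (c l * (z - 0) ^ l) \<le> n' * \<kappa> / 2 ^ l"
        by (simp add: n'_def mult.assoc)
    qed (use n'0 \<kappa> in auto)
    moreover have "(\<Sum>l<m. c l * (z - 0) ^ l) = h 0 + p z"
    proof -
      have "{..<m} = insert 0 {1..<m}"
        using m by auto
      then show ?thesis
        by (simp add: p_def c_def)
    qed
    ultimately have "cmod (h z - (h 0 + p z)) \<le> 2 * (n' * \<kappa>)"
      by simp
    moreover have "\<bar>Re (h z - (h 0 + p z))\<bar> \<le> cmod (h z - (h 0 + p z))"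
      by (rule abs_Re_le_cmod)
    ultimately show ?thesis
      by simp
  qed
  \<comment> \<open>Jensen's formula on the unit circle, solved for \<open>Re (h 0)\<close>.\<close>
  have Rh0_lower: "Re (h 0) \<ge> - A * \<kappa> - N * ln (1 + R0) - N' * ln (1 + R)"
  proof -
    have "- 2 * pi * A * \<kappa> \<le> 2 * pi * (Re (h 0) + (\<Sum>\<zeta>\<in>zeros_upto f R. \<mu> \<zeta> * ln (max 1 (cmod \<zeta>))))"
      using mean circle_log_eq[OF h, of 1] R1 by (simp add: \<mu>_def)
    then have "2 * pi * (- A * \<kappa>) \<le> 2 * pi * (Re (h 0) + (\<Sum>\<zeta>\<in>zeros_upto f R. \<mu> \<zeta> * ln (max 1 (cmod \<zeta>))))"
      by (simp add: mult_ac)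
    then have "- A * \<kappa> \<le> Re (h 0) + (\<Sum>\<zeta>\<in>zeros_upto f R. \<mu> \<zeta> * ln (max 1 (cmod \<zeta>)))"
      by (rule mult_left_le_imp_le) simp
    also have "(\<Sum>\<zeta>\<in>zeros_upto f R. \<mu> \<zeta> * ln (max 1 (cmod \<zeta>))) =
        (\<Sum>\<zeta>\<in>I. \<mu> \<zeta> * ln (max 1 (cmod \<zeta>))) + (\<Sum>\<zeta>\<in>J. \<mu> \<zeta> * ln (max 1 (cmod \<zeta>)))"
      unfolding IJ(1) using fin IJ(2) by (rule sum.union_disjoint)
    also have "(\<Sum>\<zeta>\<in>I. \<mu> \<zeta> * ln (max 1 (cmod \<zeta>))) \<le> (\<Sum>\<zeta>\<in>I. \<mu> \<zeta> * ln (1 + R0))"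
      using R0 by (intro sum_mono mult_left_mono \<mu>0 ln_mono) (auto simp: I_def)
    also have "(\<Sum>\<zeta>\<in>J. \<mu> \<zeta> * ln (max 1 (cmod \<zeta>))) \<le> (\<Sum>\<zeta>\<in>J. \<mu> \<zeta> * ln (1 + R))"
      using R1 by (intro sum_mono mult_left_mono \<mu>0 ln_mono) (auto simp: J_def zeros_upto_def)
    finally show ?thesis
      by (simp add: N_def N'_def sum_distrib_right)
  qed
  have K0: "K > 0"
    using m by (simp add: K_def)
  \<comment> \<open>Dividing the zeros by \<open>\<omega> i\<close> turns all distances
    \<open>cmod (\<omega> i * z - \<zeta>)\<close> into distances from the single point
    \<open>z\<close>, so one choice of \<open>z\<close> handles all rotations and all zeros in
    \<open>J\<close>.\<close>
  define a where "a = (\<lambda>(i, \<zeta>). \<zeta> / \<omega> i)"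
  obtain z where z: "z \<in> cball z0 \<epsilon>" and
    z_prod: "(\<Prod>x\<in>{..<K} \<times> J. cmod (z - a x) ^ zero_mult f (snd x)) \<ge> \<epsilon> ^ (\<Sum>x\<in>{..<K} \<times> J. zero_mult f (snd x))"
    by (rule exists_large_prod_linear_factors[where A = "{..<K} \<times> J" and a = a
          and \<mu> = "\<lambda>x. zero_mult f (snd x)", OF _ \<epsilon>(1)]) (use fin in auto)
  have cm\<omega>: "cmod (\<omega> i) = 1" for i
    by (simp add: \<omega>_def)
  have cm_eq: "cmod (z - a (i, \<zeta>)) = cmod (\<omega> i * z - \<zeta>)" for i \<zeta>
  proof -
    have "cmod (z - a (i, \<zeta>)) = cmod (\<omega> i * (z - a (i, \<zeta>)))"
      by (simp add: norm_mult cm\<omega>)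
    also have "\<omega> i * (z - a (i, \<zeta>)) = \<omega> i * z - \<zeta>"
      using cm\<omega>[of i] by (auto simp: a_def algebra_simps)
    finally show ?thesis .
  qed
  have z_cm: "R0 + exp 1 * (1 + R0) \<le> cmod z" "cmod z \<le> R / 2"
    using disc[OF z] by auto
  have cm_pos: "cmod (\<omega> i * z - \<zeta>) > 0" if "i < K" "\<zeta> \<in> J" for i \<zeta>
  proof -
    have "(\<Prod>x\<in>{..<K} \<times> J. cmod (z - a x) ^ zero_mult f (snd x)) \<noteq> 0"
      using z_prod zero_less_power[OF \<epsilon>(1)] by (metis not_less)
    then have "cmod (z - a (i, \<zeta>)) ^ zero_mult f \<zeta> \<noteq> 0"
      using that fin by (auto simp: prod_zero_iff)
    moreover have "zero_mult f \<zeta> > 0"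
      using that by (intro zero_mult_pos) (auto simp: J_def zeros_upto_def)
    ultimately have "cmod (z - a (i, \<zeta>)) \<noteq> 0"
      by (metis power_eq_0_iff)
    then show ?thesis
      unfolding cm_eq by simp
  qed
  define L where "L i = (\<Sum>\<zeta>\<in>J. \<mu> \<zeta> * ln (cmod (\<omega> i * z - \<zeta>)))" for i
  have posx: "cmod (z - a x) > 0" if xin: "x \<in> {..<K} \<times> J" for x
  proof -
    obtain i \<zeta> where x: "x = (i, \<zeta>)" "i < K" "\<zeta> \<in> J"
      using xin by auto
    show ?thesis
      using cm_pos[OF x(2,3)] unfolding x(1) cm_eq .
  qed
  have L_sum: "(\<Sum>i<K. L i) \<ge> real K * N' * ln \<epsilon>"
  proof -
    have "real (\<Sum>x\<in>{..<K} \<times> J. zero_mult f (snd x)) = real K * N'"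
    proof -
      have "(\<Sum>x\<in>{..<K} \<times> J. real (zero_mult f (snd x))) = (\<Sum>i<K. \<Sum>\<zeta>\<in>J. real (zero_mult f \<zeta>))"
        by (simp only: sum.cartesian_product case_prod_unfold)
      then show ?thesis
        by (simp add: N'_def \<mu>_def)
    qed
    then have "real K * N' * ln \<epsilon> = ln (\<epsilon> ^ (\<Sum>x\<in>{..<K} \<times> J. zero_mult f (snd x)))"
      using \<epsilon> by (simp add: ln_realpow)
    also have "\<dots> \<le> ln (\<Prod>x\<in>{..<K} \<times> J. cmod (z - a x) ^ zero_mult f (snd x))"
      using z_prod \<epsilon> by (intro ln_mono) auto
    also have "\<dots> = (\<Sum>x\<in>{..<K} \<times> J. ln (cmod (z - a x) ^ zero_mult f (snd x)))"
    proof (rule ln_prod)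
      fix x assume "x \<in> {..<K} \<times> J"
      from posx[OF this] show "cmod (z - a x) ^ zero_mult f (snd x) \<noteq> 0"
        by simp
    qed (use fin in auto)
    also have "\<dots> = (\<Sum>x\<in>{..<K} \<times> J. \<mu> (snd x) * ln (cmod (\<omega> (fst x) * z - snd x)))"
    proof (intro sum.cong refl)
      fix x assume "x \<in> {..<K} \<times> J"
      then show "ln (cmod (z - a x) ^ zero_mult f (snd x)) = \<mu> (snd x) * ln (cmod (\<omega> (fst x) * z - snd x))"
        using posx[of x] cm_eq[of "fst x" "snd x"] by (simp add: \<mu>_def ln_realpow)
    qed
    also have "\<dots> = (\<Sum>i<K. L i)"
      unfolding L_def by (simp add: sum.cartesian_product split_beta)
    finally show ?thesis .
  qed
  have L_upper: "L i \<le> N' * ln (2 * R)" if "i < K" for i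
    unfolding L_def N'_def sum_distrib_right
  proof (intro sum_mono mult_left_mono \<mu>0 ln_mono)
    fix \<zeta> assume \<zeta>: "\<zeta> \<in> J"
    show "0 < cmod (\<omega> i * z - \<zeta>)"
      using cm_pos[OF that \<zeta>] .
    have "cmod (\<omega> i * z - \<zeta>) \<le> cmod (\<omega> i * z) + cmod \<zeta>"
      by (rule norm_triangle_ineq4)
    also have "\<dots> \<le> R / 2 + R"
      using \<zeta> z_cm by (intro add_mono) (auto simp: norm_mult cm\<omega> J_def zeros_upto_def)
    finally show "cmod (\<omega> i * z - \<zeta>) \<le> 2 * R"
      using R1 by simp
  qed
  have key: "N * (1 + ln (1 + R0)) + L i + Re (h 0) + Re (p (\<omega> i * z)) - 2 * n' * \<kappa> \<le> M * \<kappa>" if "i < K" for i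
  proof -
    have cm: "cmod (\<omega> i * z) = cmod z"
      by (simp add: norm_mult cm\<omega>)
    have nz: "f (\<omega> i * z) \<noteq> 0"
    proof
      assume "f (\<omega> i * z) = 0"
      then have "\<omega> i * z \<in> zeros_upto f R"
        using z_cm R1 cm by (simp add: zeros_upto_def)
      moreover have "cmod (\<omega> i * z) \<ge> R0"
        using z_cm R0 cm by (smt (verit) exp_gt_zero mult_nonneg_nonneg)
      ultimately show False
        using cm_pos[OF that, of "\<omega> i * z"] by (simp add: J_def)
    qed
    have "ln (cmod (f (\<omega> i * z))) \<le> ln (exp (M * \<kappa>))"
      using bound[OF z, of i] that nz unfolding \<omega>_def K_def by (intro ln_mono) auto
    then have "(\<Sum>\<zeta>\<in>I. \<mu> \<zeta> * ln (cmod (\<omega> i * z - \<zeta>))) + L i + Re (h (\<omega> i * z)) \<le> M * \<kappa>"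
      using lnf[of "\<omega> i * z"] nz z_cm R1 cm by (simp add: L_def)
    \<comment> \<open>The distance to each inner zero is at least \<open>exp 1 * (1 + R0)\<close>;
      the factor \<open>exp 1\<close> produces the surplus 1 per zero.\<close>
    moreover have "N * (1 + ln (1 + R0)) \<le> (\<Sum>\<zeta>\<in>I. \<mu> \<zeta> * ln (cmod (\<omega> i * z - \<zeta>)))"
      unfolding N_def sum_distrib_right
    proof (intro sum_mono mult_left_mono \<mu>0)
      fix \<zeta> assume "\<zeta> \<in> I"
      then have "cmod (\<omega> i * z) - cmod \<zeta> \<ge> exp 1 * (1 + R0)"
        using z_cm cm by (simp add: I_def)
      then have "exp 1 * (1 + R0) \<le> cmod (\<omega> i * z - \<zeta>)"
        using norm_triangle_ineq2[of "\<omega> i * z" \<zeta>] by linarith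
      then have "ln (exp 1 * (1 + R0)) \<le> ln (cmod (\<omega> i * z - \<zeta>))"
        using R0 by (intro ln_mono) auto
      then show "1 + ln (1 + R0) \<le> ln (cmod (\<omega> i * z - \<zeta>))"
        using R0 by (simp add: ln_mult)
    qed
    moreover have "\<bar>Re (h (\<omega> i * z)) - Re (h 0) - Re (p (\<omega> i * z))\<bar> \<le> 2 * n' * \<kappa>"
      using z_cm cm by (intro hz) simp
    ultimately show ?thesis
      by linarith
  qed
  have p_eq: "p (\<omega> i * z) = (\<Sum>l\<in>{1..<m}. (c l * z ^ l) * cis (2 * pi * real i * real l / real (2 * m)))" for i
    unfolding p_def
  proof (intro sum.cong refl)
    fix l
    have "\<omega> i ^ l = cis (2 * pi * real i * real l / real (2 * m))"
      by (simp add: \<omega>_def K_def Complex.DeMoivre mult_ac)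
    then show "c l * (\<omega> i * z) ^ l = (c l * z ^ l) * cis (2 * pi * real i * real l / real (2 * m))"
      by (simp add: power_mult_distrib)
  qed
  have p_sum: "(\<Sum>i<K. Re (p (\<omega> i * z))) = 0"
    using trig_poly_one_sided_bound(1)[OF m, of "\<lambda>l. c l * z ^ l"] by (simp add: p_eq K_def)
  have avg: "N * (1 + ln (1 + R0)) + N' * ln \<epsilon> + Re (h 0) - 2 * n' * \<kappa> \<le> M * \<kappa>"
  proof -
    have "(\<Sum>i<K. N * (1 + ln (1 + R0)) + L i + Re (h 0) + Re (p (\<omega> i * z)) - 2 * n' * \<kappa>) \<le> (\<Sum>i<K. M * \<kappa>)"
      by (intro sum_mono key) auto
    then have "real K * (N * (1 + ln (1 + R0)) + Re (h 0) - 2 * n' * \<kappa>) + (\<Sum>i<K. L i) \<le> real K * (M * \<kappa>)"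
      unfolding sum.distrib sum_subtractf p_sum by (simp add: algebra_simps)
    then have "real K * (N * (1 + ln (1 + R0)) + N' * ln \<epsilon> + Re (h 0) - 2 * n' * \<kappa>) \<le> real K * (M * \<kappa>)"
      using L_sum by (simp add: algebra_simps)
    then show ?thesis
      using K0 by simp
  qed
  have n'\<epsilon>: "N' * (- ln \<epsilon>) \<le> n' * \<kappa> * (- ln \<epsilon>)"
    using N'_le ln_\<epsilon> by (intro mult_right_mono) auto
  have lnR: "0 \<le> ln (1 + R)" "0 \<le> ln (1 + R0)" "0 \<le> ln (2 * R)"
    using R0 by auto
  have n'R: "N' * ln (1 + R) \<le> n' * \<kappa> * ln (1 + R)" "N' * ln (2 * R) \<le> n' * \<kappa> * ln (2 * R)"
    using N'_le lnR by (auto intro: mult_right_mono)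
  \<comment> \<open>Adding \<open>avg\<close> and \<open>Rh0_lower\<close> cancels
    \<open>Re (h 0)\<close> and \<open>N * ln (1 + R0)\<close>; the surplus \<open>N\<close> is
    left.\<close>
  have N_le: "N \<le> B1 * \<kappa>"
    using avg Rh0_lower n'\<epsilon> n'R by (simp add: B1_def algebra_simps)
  have h0_le: "Re (h 0) \<le> B2 * \<kappa>"
  proof -
    have "N * (1 + ln (1 + R0)) \<ge> 0"
      using N0 lnR by simp
    then show ?thesis
      using avg n'\<epsilon> by (simp add: B2_def algebra_simps)
  qed
  have h0_ge: "Re (h 0) \<ge> - B3 * \<kappa>"
  proof -
    have "N * ln (1 + R0) \<le> B1 * \<kappa> * ln (1 + R0)"
      using N_le lnR by (intro mult_right_mono)
    then show ?thesis
      using Rh0_lower n'R by (simp add: B3_def algebra_simps)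
  qed
  have Re_p_le: "Re (p (\<omega> i * z)) \<le> B4 * \<kappa>" if "i < K" for i
  proof -
    \<comment> \<open>Only the sum of all \<open>L j\<close> is bounded below; upper bounds for the
      other terms isolate \<open>L i\<close>.\<close>
    have "(\<Sum>j<K. L j) = L i + (\<Sum>j\<in>{..<K} - {i}. L j)"
      using that by (intro sum.remove) auto
    also have "(\<Sum>j\<in>{..<K} - {i}. L j) \<le> (\<Sum>j\<in>{..<K} - {i}. N' * ln (2 * R))"
      by (intro sum_mono L_upper) auto
    also have "\<dots> \<le> (\<Sum>j<K. N' * ln (2 * R))"
      using N0 lnR by (intro sum_mono2) auto
    finally have "L i \<ge> real K * (N' * ln \<epsilon>) - real K * (N' * ln (2 * R))"
      using L_sum by (simp add: mult.assoc)
    moreover have "real K * (N' * (- ln \<epsilon>)) \<le> real K * (n' * \<kappa> * (- ln \<epsilon>))"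
      by (rule mult_left_mono[OF n'\<epsilon>]) simp
    moreover have "real K * (N' * ln (2 * R)) \<le> real K * (n' * \<kappa> * ln (2 * R))"
      by (rule mult_left_mono[OF n'R(2)]) simp
    ultimately have "- L i \<le> real K * (n' * \<kappa> * (- ln \<epsilon>)) + real K * (n' * \<kappa> * ln (2 * R))"
      by simp
    moreover have "N * (1 + ln (1 + R0)) \<ge> 0"
      using N0 lnR by simp
    ultimately show ?thesis
      using key[OF that] h0_ge by (simp add: B4_def algebra_simps)
  qed
  have c_le: "cmod (c l) \<le> 4 * (B4 * \<kappa>)" if l: "l \<in> {1..<m}" for l
  proof -
    have "cmod (c l * z ^ l) \<le> 4 * (B4 * \<kappa>)"
      by (rule trig_poly_one_sided_bound(2)[OF m _ l]) (use Re_p_le in \<open>simp add: p_eq K_def\<close>)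
    moreover have "cmod z \<ge> 1"
      using z_cm R0 by (smt (verit) exp_gt_zero mult_nonneg_nonneg)
    then have "cmod (c l) * 1 \<le> cmod (c l) * cmod z ^ l"
      by (intro mult_left_mono one_le_power) auto
    ultimately show ?thesis
      by (simp add: norm_mult norm_power)
  qed
  show ?thesis
  proof (cases "f w = 0")
    case False
    have wR: "cmod w \<le> R / 2"
      using w \<rho> by simp
    have ln_le: "ln (cmod (w - \<zeta>)) \<le> ln (2 * R)" if "\<zeta> \<in> zeros_upto f R" for \<zeta>
    proof -
      have "w \<noteq> \<zeta>"
        using False that by (auto simp: zeros_upto_def)
      moreover have "cmod (w - \<zeta>) \<le> R / 2 + R"
        using norm_triangle_ineq4[of w \<zeta>] wR that by (simp add: zeros_upto_def)
      ultimately show ?thesis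
        using R1 by (intro ln_mono) auto
    qed
    have "(\<Sum>\<zeta>\<in>I. \<mu> \<zeta> * ln (cmod (w - \<zeta>))) \<le> N * ln (2 * R)"
      unfolding N_def sum_distrib_right by (intro sum_mono mult_left_mono ln_le \<mu>0) (auto simp: I_def)
    moreover have "N * ln (2 * R) \<le> B1 * \<kappa> * ln (2 * R)"
      by (intro mult_right_mono N_le lnR)
    moreover have "(\<Sum>\<zeta>\<in>J. \<mu> \<zeta> * ln (cmod (w - \<zeta>))) \<le> N' * ln (2 * R)"
      unfolding N'_def sum_distrib_right by (intro sum_mono mult_left_mono ln_le \<mu>0) (auto simp: J_def)
    moreover have "Re (p w) \<le> 4 * (B4 * \<kappa>) * (\<Sum>l\<in>{1..<m}. \<rho> ^ l)"
    proof -
      have "Re (p w) \<le> cmod (p w)"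
        by (rule complex_Re_le_cmod)
      also have "\<dots> \<le> (\<Sum>l\<in>{1..<m}. 4 * (B4 * \<kappa>) * \<rho> ^ l)"
        unfolding p_def
      proof (rule sum_norm_le)
        fix l assume l: "l \<in> {1..<m}"
        have "cmod (c l) * cmod w ^ l \<le> 4 * (B4 * \<kappa>) * \<rho> ^ l"
          using c_le[OF l] w order_trans[OF norm_ge_zero c_le[OF l]]
          by (intro mult_mono power_mono) auto
        then show "cmod (c l * w ^ l) \<le> 4 * (B4 * \<kappa>) * \<rho> ^ l"
          by (simp add: norm_mult norm_power)
      qed
      finally show ?thesis
        by (simp add: sum_distrib_left)
    qed
    moreover have "\<bar>Re (h w) - Re (h 0) - Re (p w)\<bar> \<le> 2 * n' * \<kappa>"
      by (rule hz[OF wR])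
    moreover have "ln (cmod (f w)) = (\<Sum>\<zeta>\<in>I. \<mu> \<zeta> * ln (cmod (w - \<zeta>))) + (\<Sum>\<zeta>\<in>J. \<mu> \<zeta> * ln (cmod (w - \<zeta>))) + Re (h w)"
      using wR R1 False by (intro lnf) auto
    ultimately have "ln (cmod (f w)) \<le> B1 * \<kappa> * ln (2 * R) + n' * \<kappa> * ln (2 * R) + B2 * \<kappa>
        + 4 * (B4 * \<kappa>) * (\<Sum>l\<in>{1..<m}. \<rho> ^ l) + 2 * n' * \<kappa>"
      using n'R(2) h0_le by linarith
    also have "\<dots> = ((B1 + n') * ln (2 * R) + B2 + 4 * B4 * (\<Sum>l\<in>{1..<m}. \<rho> ^ l) + 2 * n') * \<kappa>"
      by (simp add: algebra_simps)
    finally have "exp (ln (cmod (f w))) \<le> exp (((B1 + n') * ln (2 * R) + B2 + 4 * B4 * (\<Sum>l\<in>{1..<m}. \<rho> ^ l) + 2 * n') * \<kappa>)"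
      by simp
    then show ?thesis
      using False by simp
  qed simp
qed

text \<open>The bound at all \<open>K\<close> points \<open>\<omega> i * z\<close> is built into the
  closed sets \<open>E M\<close>, so a single use of Baire's theorem serves all rotations on the
  same disc. Intersecting with a closed disc \<open>C\<close> inside \<open>U\<close> places the
  result where it is wanted.\<close>

lemma exists_uniformly_bounded_disc:
  fixes F :: "nat \<Rightarrow> complex \<Rightarrow> complex" and \<omega> :: "nat \<Rightarrow> complex" and \<kappa> :: "nat \<Rightarrow> real" and K :: nat
  assumes hol: "\<And>n. F n holomorphic_on UNIV" and \<kappa>: "\<And>n. \<kappa> n > 0"
    and ptw: "\<And>z. \<exists>M. \<forall>n. cmod (F n z) \<le> exp (M * \<kappa> n)"
    and U: "open U" "U \<noteq> {}"
  obtains z0 \<epsilon> M where "0 < \<epsilon>" "\<epsilon> \<le> 1" "cball z0 \<epsilon> \<subseteq> U"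
    "\<And>z n i. z \<in> cball z0 \<epsilon> \<Longrightarrow> i < K \<Longrightarrow> cmod (F n (\<omega> i * z)) \<le> exp (M * \<kappa> n)"
proof -
  define E where "E M = (\<Inter>n. \<Inter>i\<in>{..<K}. {z. cmod (F n (\<omega> i * z)) \<le> exp (real M * \<kappa> n)})" for M :: nat
  have cont: "continuous_on UNIV (\<lambda>z. F n (\<omega> i * z))" for n i
    by (rule continuous_on_compose2[OF holomorphic_on_imp_continuous_on[OF hol[of n]]])
       (auto intro!: continuous_intros)
  have closed_E: "closed (E M)" for M
    unfolding E_def by (intro closed_INT ballI closed_Collect_le continuous_intros cont)
  have cover: "\<exists>M. z \<in> E M" for z
  proof -
    have "\<forall>i. \<exists>M. \<forall>n. cmod (F n (\<omega> i * z)) \<le> exp (M * \<kappa> n)"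
      using ptw by blast
    then obtain M where M: "\<And>i n. cmod (F n (\<omega> i * z)) \<le> exp (M i * \<kappa> n)"
      by metis
    obtain M' :: nat where M': "Max (insert 0 (M ` {..<K})) \<le> real M'"
      using real_arch_simple by blast
    have "cmod (F n (\<omega> i * z)) \<le> exp (real M' * \<kappa> n)" if "i < K" for i n
    proof -
      have "M i \<le> real M'"
        using M' that by auto
      then have "exp (M i * \<kappa> n) \<le> exp (real M' * \<kappa> n)"
        using \<kappa>[of n] by (simp add: mult_right_mono)
      then show ?thesis
        using M[of n i] by linarith
    qed
    then show ?thesis
      by (auto simp: E_def)
  qed
  obtain u where "u \<in> U"
    using U by blast
  then obtain r where r: "r > 0" "cball u r \<subseteq> U"
    using U open_contains_cball by blast
  define C where "C = cball u r"
  have "\<exists>M. interior (E M \<inter> C) \<noteq> {}"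
  proof (rule ccontr)
    assume "\<not> (\<exists>M. interior (E M \<inter> C) \<noteq> {})"
    then have dense: "closure (- (E M \<inter> C)) = UNIV" for M
      by (metis Compl_empty_eq closure_complement)
    \<comment> \<open>If every \<open>E M \<inter> C\<close> had empty interior, the complements
      would be open and dense; their intersection is \<open>- C\<close>, because the
      \<open>E M\<close> cover the plane, and it is not dense.\<close>
    have "UNIV \<subseteq> closure (\<Inter> (range (\<lambda>M. - (E M \<inter> C))))"
    proof (rule Baire)
      fix T assume "T \<in> range (\<lambda>M. - (E M \<inter> C))"
      then obtain M where "T = - (E M \<inter> C)"
        by blast
      then show "openin (top_of_set UNIV) T \<and> UNIV \<subseteq> closure T"
        using dense[of M] closed_E[of M] by (auto simp: C_def open_Compl closed_Int)
    qed auto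
    also have "\<Inter> (range (\<lambda>M. - (E M \<inter> C))) = - C"
      using cover by auto
    finally have "interior C = {}"
      by (auto simp: closure_complement)
    then show False
      using r by (simp add: C_def)
  qed
  then obtain M z0 where "z0 \<in> interior (E M \<inter> C)"
    by blast
  then obtain e where e: "e > 0" "cball z0 e \<subseteq> interior (E M \<inter> C)"
    using open_contains_cball[of "interior (E M \<inter> C)"] open_interior by blast
  have sub: "cball z0 (min e 1) \<subseteq> E M \<inter> C"
    using e(2) interior_subset[of "E M \<inter> C"] by (auto simp: subset_iff)
  show ?thesis
  proof (rule that)
    show "0 < min e 1" "min e 1 \<le> 1"
      using e by auto
    show "cball z0 (min e 1) \<subseteq> U"
      using sub r(2) by (auto simp: C_def)
    show "cmod (F n (\<omega> i * z)) \<le> exp (real M * \<kappa> n)" if "z \<in> cball z0 (min e 1)" "i < K" for z n i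
      using sub that by (auto simp: E_def)
  qed
qed

lemma zero_count_le_full_count:
  assumes "nonzero_entire f"
  shows "real (zero_count f R) \<le> full_count f R"
proof -
  interpret nonzero_entire f
    by fact
  show ?thesis
    unfolding zero_count_def full_count_def of_nat_sum
    by (intro sum_mono2 finite_zeros_upto) (auto simp: zeros_upto_def nonzero_zeros_def)
qed

section \<open>Estimates along the sequence, uniform in the radius\<close>

text \<open>The hypotheses in quantitative form: \<open>exp (- A)\<close> is an eventual lower bound
  for the normalised geometric means on the unit circle, and \<open>tail\<close> bounds one tail sum
  at one radius, which both alternative 2 and the degree condition provide.\<close>

locale genus_zero_family =
  fixes P :: "nat \<Rightarrow> complex \<Rightarrow> complex" and k :: "nat \<Rightarrow> real" and A :: real
    and m :: nat and R0 B0 :: real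
  assumes entire: "\<And>n. genus_zero_entire (P n)"
    and k_pos: "\<And>n. k n > 0"
    and pointwise: "\<And>z e. e > 0 \<Longrightarrow> \<forall>\<^sub>F n in sequentially. cmod (P n z) \<le> exp (e * k n)"
    and mean: "\<forall>\<^sub>F n in sequentially. circle_log (P n) 1 \<ge> - 2 * pi * A * k n"
    and A: "A \<ge> 0"
    and m: "m \<ge> 1" and R0: "R0 \<ge> 1" and B0: "B0 \<ge> 0"
    and tail: "\<forall>\<^sub>F n in sequentially. abs_tail_sum (P n) m R0 \<le> ennreal (B0 * k n)"
begin

lemma entire': "nonzero_entire (P n)"
  using entire by (simp add: genus_zero_entire_def)

lemma hol: "P n holomorphic_on UNIV"
  using entire' by (simp add: nonzero_entire_def)

text \<open>The hypothesis \<open>pointwise\<close> speaks only of large \<open>n\<close>; the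
  finitely many other terms are absorbed through \<open>x \<le> exp x\<close>. Baire's theorem needs
  all \<open>n\<close>.\<close>

lemma pointwise_bounded: "\<exists>M. \<forall>n. cmod (P n z) \<le> exp (M * k n)"
proof -
  obtain n0 where n0: "\<And>n. n \<ge> n0 \<Longrightarrow> cmod (P n z) \<le> exp (1 * k n)"
    using pointwise[of 1 z] by (auto simp: eventually_sequentially)
  define M where "M = 1 + (\<Sum>n<n0. cmod (P n z) / k n)"
  have "cmod (P n z) \<le> exp (M * k n)" for n
  proof (cases "n \<ge> n0")
    case True
    have "M \<ge> 1"
      using k_pos by (auto simp: M_def intro!: sum_nonneg divide_nonneg_pos)
    then have "exp (1 * k n) \<le> exp (M * k n)"
      using k_pos[of n] by simp
    then show ?thesis
      using n0[OF True] by linarith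
  next
    case False
    have "cmod (P n z) / k n \<le> (\<Sum>n<n0. cmod (P n z) / k n)"
      using False k_pos by (intro member_le_sum) (auto intro!: divide_nonneg_pos)
    then have "cmod (P n z) / k n \<le> M"
      by (simp add: M_def)
    then have "cmod (P n z) \<le> M * k n"
      using k_pos[of n] by (simp add: pos_divide_le_eq)
    also have "\<dots> \<le> exp (M * k n)"
      using exp_ge_add_one_self[of "M * k n"] by linarith
    finally show ?thesis .
  qed
  then show ?thesis
    by blast
qed

lemma locally_bounded:
  assumes "\<rho> \<ge> 0"
  shows "\<exists>M. \<forall>\<^sub>F n in sequentially. \<forall>w. cmod w \<le> \<rho> \<longrightarrow> cmod (P n w) \<le> exp (M * k n)"
proof -
  \<comment> \<open>Beyond this radius every point is at distance at least
    \<open>exp 1 * (1 + R0)\<close> from the zeros of modulus below \<open>R0\<close>.\<close>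
  define r1 where "r1 = R0 + exp 1 * (1 + R0)"
  have "r1 > 0"
    using R0 by (simp add: r1_def add_pos_pos)
  \<comment> \<open>Both the annulus \<open>U\<close> and the disc of radius \<open>\<rho>\<close>
    have to fit into \<open>cmod z \<le> R / 2\<close>.\<close>
  define R where "R = 2 * (r1 + 1 + \<rho>)"
  have "R0 \<le> R"
    using R0 assms \<open>r1 > 0\<close> by (simp add: R_def r1_def)
  define U where "U = {z. r1 < cmod z \<and> cmod z < r1 + 1}"
  have "open U"
    unfolding U_def by (intro open_Collect_conj open_Collect_less continuous_intros)
  moreover have "of_real (r1 + 1/2) \<in> U"
    using \<open>r1 > 0\<close> unfolding U_def by (simp only: norm_of_real mem_Collect_eq) auto
  then have "U \<noteq> {}"
    by blast
  ultimately obtain z0 \<epsilon> M where disc: "0 < \<epsilon>" "\<epsilon> \<le> 1" "cball z0 \<epsilon> \<subseteq> U"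
    "\<And>z n i. z \<in> cball z0 \<epsilon> \<Longrightarrow> i < 2 * m \<Longrightarrow> cmod (P n (cis (2 * pi * real i / real (2 * m)) * z)) \<le> exp (M * k n)"
    using exists_uniformly_bounded_disc[OF hol k_pos pointwise_bounded,
        where K = "2 * m" and \<omega> = "\<lambda>i. cis (2 * pi * real i / real (2 * m))" and U = U]
    by metis
  have disc': "R0 + exp 1 * (1 + R0) \<le> cmod z \<and> cmod z \<le> R / 2" if "z \<in> cball z0 \<epsilon>" for z
  proof -
    have "z \<in> U"
      using that disc(3) by blast
    then show ?thesis
      using assms by (auto simp: U_def R_def r1_def)
  qed
  have \<rho>: "\<rho> \<le> R / 2"
    using \<open>r1 > 0\<close> by (simp add: R_def)
  \<comment> \<open>The quantifier order records that the constant of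
    \<open>local_bound_core\<close> does not depend on the function, on \<open>\<kappa>\<close> or
    on the point, so one \<open>M'\<close> serves all large \<open>n\<close>.\<close>
  have "\<exists>M'. \<forall>f \<kappa> w. genus_zero_entire f \<longrightarrow> \<kappa> > 0 \<longrightarrow> abs_tail_sum f m R0 \<le> ennreal (B0 * \<kappa>) \<longrightarrow>
      circle_log f 1 \<ge> - 2 * pi * A * \<kappa> \<longrightarrow>
      (\<forall>z i. z \<in> cball z0 \<epsilon> \<longrightarrow> i < 2 * m \<longrightarrow>
        cmod (f (cis (2 * pi * real i / real (2 * m)) * z)) \<le> exp (M * \<kappa>)) \<longrightarrow>
      cmod w \<le> \<rho> \<longrightarrow> cmod (f w) \<le> exp (M' * \<kappa>)"
    by (rule exI, intro allI impI,
        rule genus_zero_entire.local_bound_core[OF _ m _ B0 R0 \<open>R0 \<le> R\<close> assms \<rho> disc(1,2) _ _ disc',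
          where A = A and M = M]) blast+
  then obtain M' where M': "\<And>f \<kappa> w. genus_zero_entire f \<Longrightarrow> \<kappa> > 0 \<Longrightarrow> abs_tail_sum f m R0 \<le> ennreal (B0 * \<kappa>) \<Longrightarrow>
      circle_log f 1 \<ge> - 2 * pi * A * \<kappa> \<Longrightarrow>
      (\<And>z i. z \<in> cball z0 \<epsilon> \<Longrightarrow> i < 2 * m \<Longrightarrow>
        cmod (f (cis (2 * pi * real i / real (2 * m)) * z)) \<le> exp (M * \<kappa>)) \<Longrightarrow>
      cmod w \<le> \<rho> \<Longrightarrow> cmod (f w) \<le> exp (M' * \<kappa>)"
    by blast
  have "\<forall>\<^sub>F n in sequentially. \<forall>w. cmod w \<le> \<rho> \<longrightarrow> cmod (P n w) \<le> exp (M' * k n)"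
    using mean tail
  proof eventually_elim
    case (elim n)
    show ?case
      using M'[OF entire k_pos elim(2,1) disc(4)] by blast
  qed
  then show ?thesis
    by blast
qed

text \<open>The constant of \<open>locally_bounded\<close> depends on \<open>R\<close> but only
  dominates: the normalised positive parts tend to 0 pointwise, hence so do their means. The factor
  1 in front of \<open>k n\<close>, the same at every radius, makes the later constants independent
  of \<open>R\<close>.\<close>

lemma circle_log_plus_le:
  assumes "R > 0"
  shows "\<forall>\<^sub>F n in sequentially. circle_log_plus (P n) R \<le> k n"
proof -
  obtain M where "\<forall>\<^sub>F n in sequentially. \<forall>w. cmod w \<le> R \<longrightarrow> cmod (P n w) \<le> exp (M * k n)"
    using locally_bounded[of R] assms by auto
  then obtain n0 where n0: "\<And>n w. n \<ge> n0 \<Longrightarrow> cmod w \<le> R \<Longrightarrow> cmod (P n w) \<le> exp (M * k n)"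
    by (auto simp: eventually_sequentially)
  \<comment> \<open>The index is shifted by \<open>n0\<close> because domination must hold for every
    member of the sequence.\<close>
  define g where "g n t = ln (max 1 (cmod (P (n + n0) (of_real R * cis t)))) / k (n + n0)" for n t
  have cm: "cmod (of_real R * cis t) = R" for t
    using assms by (simp add: norm_mult)
  have g_int: "(g n has_integral circle_log_plus (P (n + n0)) R / k (n + n0)) {0..2*pi}" for n
    unfolding g_def circle_log_plus_def
    by (intro has_integral_divide integrable_integral nonzero_entire.integrable_circle_log_plus entire')
  have "(\<lambda>n. integral {0..2*pi} (g n)) \<longlonglongrightarrow> integral {0..2*pi} (\<lambda>_. 0 :: real)"
  proof (rule dominated_convergence)
    show "g n integrable_on {0..2*pi}" for n
      using g_int by blast
    show "(\<lambda>_. max 0 M) integrable_on {0..2*pi}"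
      by (rule integrable_const_ivl)
    show "norm (g n t) \<le> max 0 M" for n t
    proof -
      have "exp (M * k (n + n0)) \<le> exp (max 0 M * k (n + n0))"
        using k_pos[of "n + n0"] by (simp add: mult_right_mono)
      moreover have "1 \<le> exp (max 0 M * k (n + n0))"
        using k_pos[of "n + n0"] by simp
      moreover have "cmod (P (n + n0) (of_real R * cis t)) \<le> exp (M * k (n + n0))"
        using n0[of "n + n0" "of_real R * cis t"] cm[of t] by simp
      ultimately have "max 1 (cmod (P (n + n0) (of_real R * cis t))) \<le> exp (max 0 M * k (n + n0))"
        by (intro max.boundedI) linarith+
      then have "ln (max 1 (cmod (P (n + n0) (of_real R * cis t)))) \<le> ln (exp (max 0 M * k (n + n0)))"
        by (intro ln_mono) auto
      then have "g n t \<le> max 0 M"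
        unfolding g_def using k_pos[of "n + n0"] by (simp only: ln_exp pos_divide_le_eq)
      moreover have "g n t \<ge> 0"
        unfolding g_def using k_pos[of "n + n0"] by (intro divide_nonneg_pos) auto
      ultimately show ?thesis
        by simp
    qed
    show "(\<lambda>n. g n t) \<longlonglongrightarrow> 0" for t
    proof (rule LIMSEQ_I)
      fix e :: real assume "e > 0"
      then have "\<forall>\<^sub>F n in sequentially. cmod (P n (of_real R * cis t)) \<le> exp (e / 2 * k n)"
        by (intro pointwise) auto
      then obtain n1 where n1: "\<And>n. n \<ge> n1 \<Longrightarrow> cmod (P n (of_real R * cis t)) \<le> exp (e / 2 * k n)"
        by (auto simp: eventually_sequentially)
      show "\<exists>no. \<forall>n\<ge>no. norm (g n t - 0) < e"
      proof (intro exI allI impI)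
        fix n assume "n1 \<le> n"
        have "1 \<le> exp (e / 2 * k (n + n0))"
          using k_pos[of "n + n0"] \<open>e > 0\<close> by simp
        then have "max 1 (cmod (P (n + n0) (of_real R * cis t))) \<le> exp (e / 2 * k (n + n0))"
          using n1[of "n + n0"] \<open>n1 \<le> n\<close> by simp
        then have "ln (max 1 (cmod (P (n + n0) (of_real R * cis t)))) \<le> ln (exp (e / 2 * k (n + n0)))"
          by (intro ln_mono) auto
        then have "g n t \<le> e / 2"
          unfolding g_def using k_pos[of "n + n0"] by (simp only: ln_exp pos_divide_le_eq)
        moreover have "g n t \<ge> 0"
          unfolding g_def using k_pos[of "n + n0"] by (intro divide_nonneg_pos) auto
        ultimately show "norm (g n t - 0) < e"
          using \<open>e > 0\<close> by simp
      qed
    qed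
  qed
  then have "(\<lambda>n. circle_log_plus (P (n + n0)) R / k (n + n0)) \<longlonglongrightarrow> 0"
    by (simp add: integral_unique[OF g_int])
  then have "(\<lambda>n. circle_log_plus (P n) R / k n) \<longlonglongrightarrow> 0"
    by (rule LIMSEQ_offset)
  then have "\<forall>\<^sub>F n in sequentially. circle_log_plus (P n) R / k n < 1"
    by (rule order_tendstoD) simp
  then show ?thesis
  proof eventually_elim
    case (elim n)
    then show ?case
      using k_pos[of n] by (simp add: pos_divide_less_eq)
  qed
qed

text \<open>A generous common bound for the constants that arise below,
  \<open>(1 + 2 * A) / (2 * ln 2)\<close> for the zeros and \<open>4 + 6 * A\<close> for the
  coefficients; it depends on \<open>A\<close> alone.\<close>

definition growth_const :: real where "growth_const = (2 + 4 * A) / ln 2 + 2 + 2 * A"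

text \<open>The positive parts at \<open>R\<close> and \<open>2 * R\<close> are eventually at most
  \<open>k n\<close>, and by monotonicity the unit circle bounds \<open>circle_log\<close> from
  below at every larger radius. How large \<open>n\<close> must be depends on \<open>R\<close>; the
  constant does not.\<close>

lemma full_count_and_coeff_le:
  assumes "R \<ge> 1"
  shows "\<forall>\<^sub>F n in sequentially. full_count (P n) R \<le> growth_const * k n \<and>
    (\<forall>R' h l. log_cofactor (P n) R R' h \<longrightarrow> l \<ge> 1 \<longrightarrow> R ^ l * cmod ((deriv ^^ l) h 0 / fact l) \<le> growth_const * k n)"
proof -
  have "\<forall>\<^sub>F n in sequentially. circle_log_plus (P n) R \<le> k n" "\<forall>\<^sub>F n in sequentially. circle_log_plus (P n) (2 * R) \<le> k n"
    using assms by (auto intro: circle_log_plus_le)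
  then show ?thesis
    using mean
  proof eventually_elim
    case (elim n)
    interpret nonzero_entire "P n"
      by (rule entire')
    have kn: "k n > 0"
      by (rule k_pos)
    have Ak: "A * k n \<ge> 0"
      using A kn by simp
    have pi1: "k n \<le> pi * k n"
      using kn pi_gt3 by simp
    have "2 * pi * ln 2 * full_count (P n) R \<le> circle_log_plus (P n) (2 * R) - circle_log (P n) 1"
      by (rule full_count_le[OF assms])
    also have "\<dots> \<le> pi * k n + 2 * pi * A * k n"
      using elim pi1 by simp
    finally have "pi * (2 * ln 2 * full_count (P n) R) \<le> pi * (k n + 2 * A * k n)"
      by (simp add: algebra_simps)
    then have N: "2 * ln 2 * full_count (P n) R \<le> k n + 2 * A * k n"
      by (rule mult_left_le_imp_le) simp
    have ln2: "ln 2 > (0::real)" "ln 2 \<le> (1::real)"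
      using ln_2_less_1 by auto
    have "full_count (P n) R \<le> (k n + 2 * A * k n) / (2 * ln 2)"
      using N ln2 by (simp add: pos_le_divide_eq mult.commute)
    also have "\<dots> \<le> growth_const * k n"
    proof -
      have "(k n + 2 * A * k n) / (2 * ln 2) \<le> (2 * k n + 4 * A * k n) / ln 2"
        using kn Ak ln2 by (intro frac_le) auto
      also have "\<dots> \<le> (2 * k n + 4 * A * k n) / ln 2 + (2 + 2 * A) * k n"
        using kn A by simp
      also have "\<dots> = growth_const * k n"
        by (simp add: growth_const_def algebra_simps add_divide_distrib)
      finally show ?thesis .
    qed
    finally have 1: "full_count (P n) R \<le> growth_const * k n" .
    have 2: "R ^ l * cmod ((deriv ^^ l) h 0 / fact l) \<le> growth_const * k n" if "log_cofactor (P n) R R' h" "l \<ge> 1" for R' h l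
    proof -
      have "pi * R ^ l * cmod ((deriv ^^ l) h 0 / fact l)
          \<le> 2 * circle_log_plus (P n) R - circle_log (P n) R + 4 * pi * ln 2 * full_count (P n) R"
        by (rule log_cofactor_coeff_le[OF that(1) assms that(2)])
      also have "\<dots> \<le> 2 * (pi * k n) + 2 * pi * A * k n + 2 * pi * (k n + 2 * A * k n)"
      proof (intro add_mono)
        have "- circle_log (P n) R \<le> 2 * pi * A * k n"
          using circle_log_mono[of 1 R] assms elim by simp
        then show "2 * circle_log_plus (P n) R - circle_log (P n) R \<le> 2 * (pi * k n) + 2 * pi * A * k n"
          using elim pi1 by linarith
        have "2 * pi * (2 * ln 2 * full_count (P n) R) \<le> 2 * pi * (k n + 2 * A * k n)"
          using N by (rule mult_left_mono) simp
        then show "4 * pi * ln 2 * full_count (P n) R \<le> 2 * pi * (k n + 2 * A * k n)"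
          by (simp add: mult_ac)
      qed
      finally have "pi * (R ^ l * cmod ((deriv ^^ l) h 0 / fact l)) \<le> pi * ((2 + 4 * A + 2 + 2 * A) * k n)"
        by (simp add: algebra_simps)
      then have "R ^ l * cmod ((deriv ^^ l) h 0 / fact l) \<le> (2 + 4 * A + 2 + 2 * A) * k n"
        by (rule mult_left_le_imp_le) simp
      also have "\<dots> \<le> growth_const * k n"
      proof (rule mult_right_mono)
        have "(2 + 4 * A) * 1 \<le> (2 + 4 * A) * (1 / ln 2)"
          using A ln2 by (intro mult_left_mono) auto
        then show "2 + 4 * A + 2 + 2 * A \<le> growth_const"
          by (simp add: growth_const_def)
      qed (use kn in simp)
      finally show ?thesis .
    qed
    show ?case
      using 1 2 by blast
  qed
qed

text \<open>The factor \<open>l\<close> comes from the Taylor coefficient, the additional 1 from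
  zeros on the circle of radius \<open>R\<close>.\<close>

lemma tail_sum_le:
  assumes "R \<ge> 1" "l \<ge> 1"
  shows "\<forall>\<^sub>F n in sequentially. cmod (tail_sum (P n) l R) / k n \<le> (real l + 1) * growth_const / R ^ l"
  using full_count_and_coeff_le[OF assms(1)]
proof eventually_elim
  case (elim n)
  interpret genus_zero_entire "P n"
    by (rule entire)
  obtain R' h where h: "log_cofactor (P n) R R' h"
    by (rule exists_log_cofactor)
  have Rl: "R ^ l > 0"
    using assms by simp
  have "cmod (tail_sum (P n) l R) \<le> real l * cmod ((deriv ^^ l) h 0 / fact l) + full_count (P n) R / R ^ l"
    using assms by (intro cmod_tail_sum_le[OF h]) auto
  also have "\<dots> \<le> real l * (growth_const * k n / R ^ l) + growth_const * k n / R ^ l"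
  proof (intro add_mono mult_left_mono divide_right_mono)
    show "cmod ((deriv ^^ l) h 0 / fact l) \<le> growth_const * k n / R ^ l"
      using elim h assms(2) Rl by (simp add: pos_le_divide_eq mult.commute)
  qed (use elim Rl in auto)
  also have "\<dots> = (real l + 1) * growth_const / R ^ l * k n"
    by (simp add: add_divide_distrib algebra_simps)
  finally show ?case
    using k_pos[of n] by (simp add: pos_divide_le_eq)
qed

lemma tail_sum_limsup_tendsto_0:
  assumes "l \<ge> 1"
  shows "((\<lambda>R::real. limsup (\<lambda>n. ennreal (cmod (tail_sum (P n) l R) / k n))) \<longlongrightarrow> 0) at_top"
proof (rule tendsto_sandwich[OF _ _ tendsto_const])
  show "\<forall>\<^sub>F R in at_top. limsup (\<lambda>n. ennreal (cmod (tail_sum (P n) l R) / k n)) \<le> ennreal ((real l + 1) * growth_const / R ^ l)"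
    using eventually_ge_at_top[of 1]
  proof eventually_elim
    case (elim R)
    show ?case
      using tail_sum_le[OF elim assms]
      by (intro Limsup_bounded) (auto elim!: eventually_mono intro: ennreal_leI)
  qed
  have "((\<lambda>R. (real l + 1) * growth_const / R ^ l) \<longlongrightarrow> 0) at_top"
    using assms by (intro real_tendsto_divide_at_top tendsto_const filterlim_pow_at_top filterlim_ident) auto
  then have "((\<lambda>R. ennreal ((real l + 1) * growth_const / R ^ l)) \<longlongrightarrow> ennreal 0) at_top"
    by (rule tendsto_ennrealI)
  then show "((\<lambda>R. ennreal ((real l + 1) * growth_const / R ^ l)) \<longlongrightarrow> 0) at_top"
    by simp
qed auto

text \<open>Diagonal choice: the count in radius \<open>j + 1\<close> is at most
  \<open>growth_const * k n\<close> from some index \<open>N j\<close> on, and the radii grow slowly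
  enough to respect \<open>N\<close>.\<close>

lemma exists_radii:
  "\<exists>r :: nat \<Rightarrow> real. (\<forall>n. r n > 0) \<and> filterlim r at_top sequentially
    \<and> limsup (\<lambda>n. ennreal (real (zero_count (P n) (r n)) / k n)) < \<infinity>"
proof -
  have "\<exists>N. \<forall>n\<ge>N. real (zero_count (P n) (real (Suc j))) \<le> growth_const * k n" for j
  proof -
    have "\<forall>\<^sub>F n in sequentially. real (zero_count (P n) (real (Suc j))) \<le> growth_const * k n"
      using full_count_and_coeff_le[of "real (Suc j)"]
      by (auto elim!: eventually_mono intro: order_trans[OF zero_count_le_full_count[OF entire']])
    then show ?thesis
      by (simp add: eventually_sequentially)
  qed
  then obtain N where N: "\<And>j n. n \<ge> N j \<Longrightarrow> real (zero_count (P n) (real (Suc j))) \<le> growth_const * k n"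
    by metis
  \<comment> \<open>The largest index permitted at \<open>n\<close>; the cap
    \<open>j \<le> n\<close> makes the set finite, and 0 is the value while nothing is
    permitted.\<close>
  define J where "J n = Max (insert 0 {j. j \<le> n \<and> N j \<le> n})" for n
  have fin: "finite {j. j \<le> n \<and> N j \<le> n}" for n
    by simp
  have J: "J n \<ge> j" if "n \<ge> max j (N j)" for j n
    unfolding J_def using fin that by (intro Max_ge) auto
  have Jin: "N (J n) \<le> n" if "n \<ge> N 0" for n
  proof -
    have "J n \<in> insert 0 {j. j \<le> n \<and> N j \<le> n}"
      unfolding J_def using fin by (intro Max_in) auto
    then show ?thesis
      using that by auto
  qed
  define r where "r n = real (Suc (J n))" for n
  have "filterlim J at_top sequentially"
    unfolding filterlim_at_top eventually_sequentially using J by blast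
  then have "filterlim r at_top sequentially"
    unfolding r_def by (intro filterlim_compose[OF filterlim_real_sequentially] filterlim_compose[OF filterlim_Suc])
  moreover have "\<forall>\<^sub>F n in sequentially. ennreal (real (zero_count (P n) (r n)) / k n) \<le> ennreal growth_const"
    using eventually_ge_at_top[of "N 0"]
  proof eventually_elim
    case (elim n)
    have "real (zero_count (P n) (r n)) \<le> growth_const * k n"
      unfolding r_def by (intro N Jin elim)
    then show ?case
      using k_pos[of n] by (intro ennreal_leI) (simp add: pos_divide_le_eq)
  qed
  then have "limsup (\<lambda>n. ennreal (real (zero_count (P n) (r n)) / k n)) \<le> ennreal growth_const"
    by (rule Limsup_bounded)
  then have "limsup (\<lambda>n. ennreal (real (zero_count (P n) (r n)) / k n)) < \<infinity>"
    using ennreal_less_top[of growth_const] by (simp add: le_less_trans)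
  ultimately show ?thesis
    by (intro exI[of _ r]) (auto simp: r_def)
qed

end

section \<open>Tail sums\<close>

lemma abs_tail_sum_antimono:
  assumes "R \<le> S"
  shows "abs_tail_sum f m S \<le> abs_tail_sum f m R"
  unfolding abs_tail_sum_def
  by (rule infsum_mono_neutral) (use assms in \<open>auto intro: nonneg_summable_on_complete\<close>)

lemma abs_tail_sum_Suc_le:
  assumes "R > 0"
  shows "abs_tail_sum f (Suc m) R \<le> ennreal (1 / R) * abs_tail_sum f m R"
proof -
  let ?A = "{z \<in> nonzero_zeros f. cmod z \<ge> R}"
  have "(\<Sum>\<zeta>\<in>F. of_nat (zero_mult f \<zeta>) * ennreal (1 / cmod \<zeta> ^ Suc m))
      \<le> ennreal (1 / R) * abs_tail_sum f m R" if F: "finite F" "F \<subseteq> ?A" for F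
  proof -
    have "(\<Sum>\<zeta>\<in>F. of_nat (zero_mult f \<zeta>) * ennreal (1 / cmod \<zeta> ^ Suc m))
        \<le> (\<Sum>\<zeta>\<in>F. ennreal (1 / R) * (of_nat (zero_mult f \<zeta>) * ennreal (1 / cmod \<zeta> ^ m)))"
    proof (rule sum_mono)
      fix \<zeta> assume "\<zeta> \<in> F"
      then have "cmod \<zeta> \<ge> R"
        using F by auto
      have "1 / cmod \<zeta> ^ Suc m = (1 / cmod \<zeta>) * (1 / cmod \<zeta> ^ m)"
        by simp
      also have "\<dots> \<le> (1 / R) * (1 / cmod \<zeta> ^ m)"
        using \<open>cmod \<zeta> \<ge> R\<close> assms by (intro mult_right_mono frac_le) auto
      finally have "ennreal (1 / cmod \<zeta> ^ Suc m) \<le> ennreal (1 / R) * ennreal (1 / cmod \<zeta> ^ m)"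
        using assms by (subst ennreal_mult[symmetric]) (auto intro!: ennreal_leI)
      then have "of_nat (zero_mult f \<zeta>) * ennreal (1 / cmod \<zeta> ^ Suc m)
          \<le> of_nat (zero_mult f \<zeta>) * (ennreal (1 / R) * ennreal (1 / cmod \<zeta> ^ m))"
        by (rule mult_left_mono) simp
      then show "of_nat (zero_mult f \<zeta>) * ennreal (1 / cmod \<zeta> ^ Suc m)
          \<le> ennreal (1 / R) * (of_nat (zero_mult f \<zeta>) * ennreal (1 / cmod \<zeta> ^ m))"
        by (simp only: mult.left_commute)
    qed
    also have "\<dots> = ennreal (1 / R) * (\<Sum>\<zeta>\<in>F. of_nat (zero_mult f \<zeta>) * ennreal (1 / cmod \<zeta> ^ m))"
      by (simp add: sum_distrib_left)
    also have "\<dots> \<le> ennreal (1 / R) * abs_tail_sum f m R"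
      unfolding abs_tail_sum_def using F
      by (intro mult_left_mono, subst nonneg_infsum_complete) (auto intro!: SUP_upper)
    finally show ?thesis .
  qed
  then show ?thesis
    unfolding abs_tail_sum_def[of f "Suc m"]
    by (subst nonneg_infsum_complete) (auto intro!: SUP_least)
qed

lemma abs_tail_sum_le_degree_star:
  assumes "R > 1"
  shows "abs_tail_sum f 1 R \<le> degree_star f"
proof -
  have "abs_tail_sum f 1 R \<le> (\<Sum>\<^sub>\<infinity>z \<in> {z \<in> nonzero_zeros f. cmod z > 1}.
        of_nat (zero_mult f z) * ennreal (1 / cmod z))"
    unfolding abs_tail_sum_def power_one_right
    by (rule infsum_mono_neutral) (use assms in \<open>auto intro: nonneg_summable_on_complete\<close>)
  then show ?thesis
    unfolding degree_star_def by (rule add_increasing[OF zero_le])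
qed

lemma ennreal_le_of_divide_less:
  assumes "x / ennreal \<kappa> < ennreal b" "\<kappa> > 0" "b \<ge> 0"
  shows "x \<le> ennreal (b * \<kappa>)"
proof -
  have "x = x / ennreal \<kappa> * ennreal \<kappa>"
    using assms(2) by (simp add: ennreal_divide_times ennreal_mult_divide_eq)
  also have "\<dots> \<le> ennreal b * ennreal \<kappa>"
    using assms(1) by (intro mult_right_mono) auto
  also have "\<dots> = ennreal (b * \<kappa>)"
    using assms by (simp add: ennreal_mult)
  finally show ?thesis .
qed

lemma eventually_le_of_limsup_less:
  assumes "limsup (\<lambda>n. X n / ennreal (k n)) < ennreal b" "\<And>n. k n > 0" "b \<ge> 0"
  shows "\<forall>\<^sub>F n in sequentially. X n \<le> ennreal (b * k n)"
  using Limsup_lessD[OF assms(1)] by eventually_elim (rule ennreal_le_of_divide_less[OF _ assms(2,3)])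

lemma limsup_abs_tail_sum_Suc_tendsto_0:
  fixes k :: "nat \<Rightarrow> real"
  assumes bd: "\<forall>\<^sub>F n in sequentially. abs_tail_sum (P n) m R0 \<le> ennreal (b * k n)"
    and k: "\<And>n. k n > 0" and "b \<ge> 0" "R0 > 0"
  shows "((\<lambda>R::real. limsup (\<lambda>n. abs_tail_sum (P n) (Suc m) R / ennreal (k n))) \<longlongrightarrow> 0) at_top"
proof (rule tendsto_sandwich[OF _ _ tendsto_const])
  show "\<forall>\<^sub>F R in at_top. limsup (\<lambda>n. abs_tail_sum (P n) (Suc m) R / ennreal (k n)) \<le> ennreal (b / R)"
    using eventually_ge_at_top[of R0]
  proof eventually_elim
    case (elim R)
    have "\<forall>\<^sub>F n in sequentially. abs_tail_sum (P n) (Suc m) R / ennreal (k n) \<le> ennreal (b / R)"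
      using bd
    proof eventually_elim
      case (elim n)
      have "abs_tail_sum (P n) (Suc m) R \<le> ennreal (1 / R) * abs_tail_sum (P n) m R"
        using \<open>R0 \<le> R\<close> \<open>R0 > 0\<close> by (intro abs_tail_sum_Suc_le) auto
      also have "\<dots> \<le> ennreal (1 / R) * ennreal (b * k n)"
        using abs_tail_sum_antimono[OF \<open>R0 \<le> R\<close>, of "P n" m] elim by (intro mult_left_mono) auto
      also have "\<dots> = ennreal (b / R) * ennreal (k n)"
        using \<open>R0 \<le> R\<close> \<open>R0 > 0\<close> \<open>b \<ge> 0\<close> k[of n] by (simp flip: ennreal_mult)
      finally show ?case
        using k[of n] by (intro divide_le_posI_ennreal) (auto simp: mult.commute)
    qed
    then show ?case
      by (rule Limsup_bounded)
  qed
  have "((\<lambda>R. b / R) \<longlongrightarrow> 0) at_top"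
    by real_asymp
  then have "((\<lambda>R. ennreal (b / R)) \<longlongrightarrow> ennreal 0) at_top"
    by (rule tendsto_ennrealI)
  then show "((\<lambda>R. ennreal (b / R)) \<longlongrightarrow> 0) at_top"
    by simp
qed auto

theorem theorem3:
  fixes P :: "nat \<Rightarrow> complex \<Rightarrow> complex" and k :: "nat \<Rightarrow> real"
  assumes genus: "\<And>n. genus_zero (P n)"
    and nonzero: "\<And>n. \<exists>z. P n z \<noteq> 0"
    and k_pos: "\<And>n. k n > 0"
    and mean: "liminf (\<lambda>n. ennreal (circle_geom_mean (P n) 1 powr (1 / k n))) > 0"
    and bound: "\<And>z. limsup (\<lambda>n. ennreal (cmod (P n z) powr (1 / k n))) \<le> 1"
  shows
    "((\<forall>m\<ge>1. ((\<lambda>R::real. limsup (\<lambda>n. abs_tail_sum (P n) m R / ennreal (k n)))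
                 \<longlongrightarrow> \<infinity>) at_top)
      \<or> (\<exists>m\<ge>1. ((\<lambda>R::real. limsup (\<lambda>n. abs_tail_sum (P n) m R / ennreal (k n)))
                 \<longlongrightarrow> 0) at_top))
     \<and> ((\<exists>m\<ge>1. ((\<lambda>R::real. limsup (\<lambda>n. abs_tail_sum (P n) m R / ennreal (k n)))
                 \<longlongrightarrow> 0) at_top)
        \<longrightarrow> (\<forall>l\<ge>1. ((\<lambda>R::real. limsup (\<lambda>n. ennreal (cmod (tail_sum (P n) l R) / k n)))
                 \<longlongrightarrow> 0) at_top))
     \<and> ((\<forall>n. ennreal (k n) \<ge> degree_star (P n))
        \<longrightarrow> (\<exists>m\<ge>1. ((\<lambda>R::real. limsup (\<lambda>n. abs_tail_sum (P n) m R / ennreal (k n)))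
                 \<longlongrightarrow> 0) at_top)
          \<and> ((\<lambda>R::real. limsup (\<lambda>n. ennreal (cmod (tail_sum (P n) 1 R) / k n)))
                 \<longlongrightarrow> 0) at_top
          \<and> (\<exists>r :: nat \<Rightarrow> real. (\<forall>n. r n > 0) \<and> filterlim r at_top sequentially
               \<and> limsup (\<lambda>n. ennreal (real (zero_count (P n) (r n)) / k n)) < \<infinity>))"
proof -
  let ?T = "\<lambda>m R. limsup (\<lambda>n. abs_tail_sum (P n) m R / ennreal (k n))"
  have entire: "genus_zero_entire (P n)" for n
    using genus[of n] nonzero[of n]
    by (simp add: genus_zero_def genus_zero_entire_def genus_zero_entire_axioms_def nonzero_entire_def)
  have pw: "\<forall>\<^sub>F n in sequentially. cmod (P n z) \<le> exp (e * k n)" if "e > 0" for z e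
  proof -
    have "1 < ennreal (exp e)"
      using that by (simp flip: ennreal_1 add: ennreal_less_iff)
    with bound[of z] have "limsup (\<lambda>n. ennreal (cmod (P n z) powr (1 / k n))) < ennreal (exp e)"
      by (rule le_less_trans)
    from Limsup_lessD[OF this] show ?thesis
    proof eventually_elim
      case (elim n)
      then have "cmod (P n z) powr (1 / k n) < exp e"
        by (simp add: ennreal_less_iff)
      then have "(cmod (P n z) powr (1 / k n)) powr k n \<le> exp e powr k n"
        using k_pos[of n] by (intro powr_mono2) auto
      then show ?case
        using k_pos[of n] by (simp add: powr_powr exp_powr_real)
    qed
  qed
  obtain c where c: "c > 0" "c < 1" "\<forall>\<^sub>F n in sequentially. circle_geom_mean (P n) 1 powr (1 / k n) > c"
  proof -
    obtain y where y: "0 < y" "y < liminf (\<lambda>n. ennreal (circle_geom_mean (P n) 1 powr (1 / k n)))"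
      using mean dense by blast
    then obtain c' where c': "y = ennreal c'" "c' > 0"
      by (cases y) (auto simp: ennreal_zero_less_top)
    have "\<forall>\<^sub>F n in sequentially. circle_geom_mean (P n) 1 powr (1 / k n) > min c' (1/2)"
      using less_LiminfD[OF y(2)]
    proof eventually_elim
      case (elim n)
      then show ?case
        using c' by (simp add: ennreal_less_iff min_less_iff_disj)
    qed
    then show ?thesis
      using c' by (intro that[of "min c' (1/2)"]) auto
  qed
  \<comment> \<open>The lower bound \<open>c\<close> was cut off at 1/2 so that \<open>A\<close> is
    nonnegative.\<close>
  define A where "A = - ln c"
  have A: "A \<ge> 0"
    using c by (simp add: A_def)
  have mean': "\<forall>\<^sub>F n in sequentially. circle_log (P n) 1 \<ge> - 2 * pi * A * k n"
    using c(3)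
  proof eventually_elim
    case (elim n)
    define x where "x = circle_log (P n) 1 / (2 * pi)"
    have "circle_geom_mean (P n) 1 = exp x"
      by (simp add: circle_geom_mean_def circle_log_def x_def)
    then have "c < exp (x / k n)"
      using elim by (simp add: exp_powr_real)
    then have "ln c < x / k n"
      using c(1) by (metis exp_gt_zero ln_exp ln_less_cancel_iff)
    then have "ln c * k n < x"
      using k_pos[of n] by (simp add: pos_less_divide_eq)
    then have "2 * pi * (ln c * k n) < 2 * pi * x"
      by simp
    then show ?case
      by (simp add: x_def A_def)
  qed
  have family: "genus_zero_family P k A m R0 b"
    if "m \<ge> 1" "R0 \<ge> 1" "b \<ge> 0" "\<forall>\<^sub>F n in sequentially. abs_tail_sum (P n) m R0 \<le> ennreal (b * k n)" for m R0 b
    using entire k_pos pw mean' A that by (intro genus_zero_family.intro) auto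
  have dichotomy: "(\<forall>m\<ge>1. (?T m \<longlongrightarrow> \<infinity>) at_top) \<or> (\<exists>m\<ge>1. (?T m \<longlongrightarrow> 0) at_top)"
  proof (rule disjCI)
    assume "\<not> (\<exists>m\<ge>1. (?T m \<longlongrightarrow> 0) at_top)"
    then have no: "\<not> (?T m \<longlongrightarrow> 0) at_top" if "m \<ge> 1" for m
      using that by blast
    show "\<forall>m\<ge>1. (?T m \<longlongrightarrow> \<infinity>) at_top"
    proof (intro allI impI)
      fix m :: nat assume "m \<ge> 1"
      have "\<forall>\<^sub>F R in at_top. ennreal b < ?T m R" if "b \<ge> 0" for b
        using eventually_gt_at_top[of 0]
      proof eventually_elim
        case (elim R)
        show ?case
        proof (rule ccontr)
          \<comment> \<open>A finite value at a single radius \<open>R > 0\<close> already forces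
            alternative 2 for the exponent \<open>Suc m\<close>.\<close>
          assume "\<not> ennreal b < ?T m R"
          then have "?T m R < ennreal (b + 1)"
            using \<open>b \<ge> 0\<close> by (meson ennreal_lessI leI le_less_trans less_add_one add_nonneg_pos zero_less_one)
          then have "\<forall>\<^sub>F n in sequentially. abs_tail_sum (P n) m R \<le> ennreal ((b + 1) * k n)"
            using k_pos \<open>b \<ge> 0\<close> by (intro eventually_le_of_limsup_less) auto
          from limsup_abs_tail_sum_Suc_tendsto_0[OF this k_pos _ \<open>R > 0\<close>]
          have "(?T (Suc m) \<longlongrightarrow> 0) at_top"
            using \<open>b \<ge> 0\<close> by simp
          then show False
            using no[of "Suc m"] by simp
        qed
      qed
      then show "(?T m \<longlongrightarrow> \<infinity>) at_top"
        by (simp add: tendsto_top_iff_ennreal)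
    qed
  qed
  have alt2: "\<forall>l\<ge>1. ((\<lambda>R::real. limsup (\<lambda>n. ennreal (cmod (tail_sum (P n) l R) / k n))) \<longlongrightarrow> 0) at_top"
    if alt: "\<exists>m\<ge>1. (?T m \<longlongrightarrow> 0) at_top"
  proof -
    \<comment> \<open>The convergence is used through one radius \<open>R0\<close> at which the
      limsup is below 1; this gives the tail bound of the locale with constant 1.\<close>
    obtain m where m: "m \<ge> 1" "(?T m \<longlongrightarrow> 0) at_top"
      using alt by blast
    have "\<forall>\<^sub>F R in at_top. ?T m R < ennreal 1"
      using m(2) by (rule order_tendstoD) simp
    then have "\<forall>\<^sub>F R in at_top. ?T m R < ennreal 1 \<and> R \<ge> 1"
      using eventually_ge_at_top by (rule eventually_conj)
    from eventually_happens[OF this] obtain R0 where R0: "?T m R0 < ennreal 1" "R0 \<ge> 1"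
      by (auto simp: trivial_limit_at_top_linorder)
    have "\<forall>\<^sub>F n in sequentially. abs_tail_sum (P n) m R0 \<le> ennreal (1 * k n)"
      by (rule eventually_le_of_limsup_less[OF R0(1) k_pos]) simp
    then interpret genus_zero_family P k A m R0 1
      using m R0 by (intro family) auto
    show ?thesis
      using tail_sum_limsup_tendsto_0 by blast
  qed
  have degree: "(\<exists>m\<ge>1. (?T m \<longlongrightarrow> 0) at_top)
      \<and> (\<exists>r :: nat \<Rightarrow> real. (\<forall>n. r n > 0) \<and> filterlim r at_top sequentially
               \<and> limsup (\<lambda>n. ennreal (real (zero_count (P n) (r n)) / k n)) < \<infinity>)"
    if deg: "\<forall>n. ennreal (k n) \<ge> degree_star (P n)"
  proof
    \<comment> \<open>Radius 2 exceeds 1, so every term of the tail sum occurs in the infinite sum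
      of \<open>degree_star\<close>. The bound for exponent 1 then yields the limit 0 for exponent
      2.\<close>
    have bd: "\<forall>\<^sub>F n in sequentially. abs_tail_sum (P n) 1 2 \<le> ennreal (1 * k n)"
      using deg by (intro always_eventually allI order_trans[OF abs_tail_sum_le_degree_star]) auto
    have "(?T (Suc 1) \<longlongrightarrow> 0) at_top"
      by (rule limsup_abs_tail_sum_Suc_tendsto_0[OF bd k_pos]) auto
    then show "\<exists>m\<ge>1. (?T m \<longlongrightarrow> 0) at_top"
      by (intro exI[of _ "Suc 1"]) simp
    \<comment> \<open>The locale asks for a bounded tail sum, so the exponent stays at 1 here
      although alternative 2 was shown with exponent 2.\<close>
    interpret genus_zero_family P k A 1 2 1
      using bd by (intro family) auto
    show "\<exists>r :: nat \<Rightarrow> real. (\<forall>n. r n > 0) \<and> filterlim r at_top sequentially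
               \<and> limsup (\<lambda>n. ennreal (real (zero_count (P n) (r n)) / k n)) < \<infinity>"
      by (rule exists_radii)
  qed
  show ?thesis
    using dichotomy alt2 degree by (intro conjI impI) blast+
qed

end
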